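(* Let $M=(m_{ij})_{i,j\in I}$ and $M'$ be Coxeter matrices over finite sets $I$ and $I'$, and let $\Phi:\mathrm{Br}^+(M)\to \mathrm{Br}^+(M')$ be a standard homomorphism of Artin monoids, $\Phi(T_i)=T_{w_\circ^{J_i}}$ with $J_i\subset I'$ of finite type, $i\in I$. Then the assignments $s_i\mapsto w_\circ^{J_i}$, $i\in I$, define both a homomorphism of Coxeter groups $W(M)\to W(M')$ and a homomorphism of Hecke monoids $(W(M),\star)\to (W(M'),\star)$. (That is, $\Phi$ yields a pair of homomorphisms of Coxeter groups and of the corresponding Hecke monoids which coincide on generators.)
   Context: A Coxeter matrix over a finite set $I$ is a symmetric matrix $M=(m_{ij})_{i,j\in I}$ with $m_{ii}=1$ and $m_{ij}\in\mathbb Z_{\ge2}\cup\{\infty\}$ for $i\ne j$. The Artin monoid $\mathrm{Br}^+(M)$ is the monoid generated by $T_i$, $i\in I$, subject to $T_iT_jT_i\cdots=T_jT_iT_j\cdots$ ($m_{ij}$ factors on each side) for $i\neq j$ with $m_{ij}<\infty$. The Coxeter group $W(M)$ is generated by $s_i$, $i\in I$, subject to $(s_is_j)^{m_{ij}}=1$ for all $i,j$ with $m_{ij}<\infty$. The Hecke monoid $(W(M),\star)$ is generated by $s_i$, $i\in I$, subject to $s_i\star s_i=s_i$ and the same braid relations; it is identified, as a set, with $W(M)$ so that $s_i\star w=s_iw$ if $\ell(s_iw)>\ell(w)$ and $s_i\star w=w$ otherwise. For $w\in W(M)$ with reduced expression $w=s_{i_1}\cdots s_{i_k}$ put $T_w=T_{i_1}\cdots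 T_{i_k}\in \mathrm{Br}^+(M)$ (independent of the reduced expression). A subset $J\subset I$ is of finite type if the parabolic subgroup $W_J(M)=\langle s_j: j\in J\rangle$ is finite; then $w_\circ^J$ is its longest element. A homomorphism of Artin monoids $\Phi:\mathrm{Br}^+(M)\to\mathrm{Br}^+(M')$ (homomorphisms of monoids preserve the identity) is called standard if for every $i\in I$ one has $\Phi(T_i)=T_{w_\circ^{J_i}}$ for some $J_i\subset I'$ of finite type. *)

theory Defs
  imports "HOL-Algebra.Generated_Groups" "HOL-Library.Extended_Nat"
begin

section \<open>Presentations of monoids and groups\<close>

inductive word_cong :: "'a set \<Rightarrow> ('a list \<times> 'a list) set \<Rightarrow> 'a list \<Rightarrow> 'a list \<Rightarrow> bool"
  for X :: "'a set" and R :: "('a list \<times> 'a list) set" where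
  rel: "(u, v) \<in> R \<Longrightarrow> u \<in> lists X \<Longrightarrow> v \<in> lists X \<Longrightarrow> a \<in> lists X \<Longrightarrow> b \<in> lists X
        \<Longrightarrow> word_cong X R (a @ u @ b) (a @ v @ b)"
| refl: "w \<in> lists X \<Longrightarrow> word_cong X R w w"
| sym: "word_cong X R u v \<Longrightarrow> word_cong X R v u"
| trans: "word_cong X R u v \<Longrightarrow> word_cong X R v w \<Longrightarrow> word_cong X R u w"

definition word_class :: "'a set \<Rightarrow> ('a list \<times> 'a list) set \<Rightarrow> 'a list \<Rightarrow> 'a list set" where
  "word_class X R w = {v. word_cong X R w v}"

definition presented_monoid :: "'a set \<Rightarrow> ('a list \<times> 'a list) set \<Rightarrow> 'a list set monoid" where
  "presented_monoid X R =
     \<lparr>carrier = word_class X R ` lists X,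
      mult = (\<lambda>A B. \<Union>a\<in>A. \<Union>b\<in>B. word_class X R (a @ b)),
      one = word_class X R []\<rparr>"

text \<open>A group presentation is turned into a monoid presentation by using signed letters:
  \<open>(x, True)\<close> stands for the generator \<open>x\<close> and \<open>(x, False)\<close> for its formal inverse.\<close>

definition group_rels ::
  "'a set \<Rightarrow> (('a \<times> bool) list \<times> ('a \<times> bool) list) set
     \<Rightarrow> (('a \<times> bool) list \<times> ('a \<times> bool) list) set" where
  "group_rels X R = R \<union> {([(x, b), (x, \<not> b)], []) | x b. x \<in> X}"

definition presented_group ::
  "'a set \<Rightarrow> (('a \<times> bool) list \<times> ('a \<times> bool) list) set \<Rightarrow> ('a \<times> bool) list set monoid" where
  "presented_group X R = presented_monoid (X \<times> UNIV) (group_rels X R)"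

definition monoid_hom :: "('a, 'c) monoid_scheme \<Rightarrow> ('b, 'd) monoid_scheme \<Rightarrow> ('a \<Rightarrow> 'b) set" where
  "monoid_hom G H = {h \<in> hom G H. h \<one>\<^bsub>G\<^esub> = \<one>\<^bsub>H\<^esub>}"

section \<open>Coxeter matrices and their Artin monoids, Coxeter groups and Hecke monoids\<close>

definition coxeter_matrix :: "'i set \<Rightarrow> ('i \<Rightarrow> 'i \<Rightarrow> enat) \<Rightarrow> bool" where
  "coxeter_matrix I m \<longleftrightarrow>
     (\<forall>i\<in>I. m i i = 1) \<and>
     (\<forall>i\<in>I. \<forall>j\<in>I. m i j = m j i) \<and>
     (\<forall>i\<in>I. \<forall>j\<in>I. i \<noteq> j \<longrightarrow> 2 \<le> m i j)"

primrec alt_word :: "nat \<Rightarrow> 'i \<Rightarrow> 'i \<Rightarrow> 'i list" where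
  "alt_word 0 i j = []"
| "alt_word (Suc n) i j = i # alt_word n j i"

definition braid_rels :: "'i set \<Rightarrow> ('i \<Rightarrow> 'i \<Rightarrow> enat) \<Rightarrow> ('i list \<times> 'i list) set" where
  "braid_rels I m =
     {(alt_word n i j, alt_word n j i) | n i j. i \<in> I \<and> j \<in> I \<and> i \<noteq> j \<and> m i j = enat n}"

definition artin_class :: "'i set \<Rightarrow> ('i \<Rightarrow> 'i \<Rightarrow> enat) \<Rightarrow> 'i list \<Rightarrow> 'i list set" where
  "artin_class I m = word_class I (braid_rels I m)"

definition artin_monoid :: "'i set \<Rightarrow> ('i \<Rightarrow> 'i \<Rightarrow> enat) \<Rightarrow> 'i list set monoid" where
  "artin_monoid I m = presented_monoid I (braid_rels I m)"

definition artin_gen :: "'i set \<Rightarrow> ('i \<Rightarrow> 'i \<Rightarrow> enat) \<Rightarrow> 'i \<Rightarrow> 'i list set" where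
  "artin_gen I m i = artin_class I m [i]"

definition coxeter_rels ::
  "'i set \<Rightarrow> ('i \<Rightarrow> 'i \<Rightarrow> enat) \<Rightarrow> (('i \<times> bool) list \<times> ('i \<times> bool) list) set" where
  "coxeter_rels I m =
     {(concat (replicate n [(i, True), (j, True)]), []) | n i j. i \<in> I \<and> j \<in> I \<and> m i j = enat n}"

definition coxeter_group ::
  "'i set \<Rightarrow> ('i \<Rightarrow> 'i \<Rightarrow> enat) \<Rightarrow> ('i \<times> bool) list set monoid" where
  "coxeter_group I m = presented_group I (coxeter_rels I m)"

text \<open>The element \<open>s\<^sub>i\<^sub>1 \<cdots> s\<^sub>i\<^sub>k\<close> of the Coxeter group.\<close>

definition coxeter_class ::
  "'i set \<Rightarrow> ('i \<Rightarrow> 'i \<Rightarrow> enat) \<Rightarrow> 'i list \<Rightarrow> ('i \<times> bool) list set" where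
  "coxeter_class I m is =
     word_class (I \<times> UNIV) (group_rels I (coxeter_rels I m)) (map (\<lambda>i. (i, True)) is)"

definition coxeter_gen ::
  "'i set \<Rightarrow> ('i \<Rightarrow> 'i \<Rightarrow> enat) \<Rightarrow> 'i \<Rightarrow> ('i \<times> bool) list set" where
  "coxeter_gen I m i = coxeter_class I m [i]"

definition coxeter_length ::
  "'i set \<Rightarrow> ('i \<Rightarrow> 'i \<Rightarrow> enat) \<Rightarrow> ('i \<times> bool) list set \<Rightarrow> nat" where
  "coxeter_length I m w = (LEAST n. \<exists>is\<in>lists I. length is = n \<and> coxeter_class I m is = w)"

definition reduced_expr ::
  "'i set \<Rightarrow> ('i \<Rightarrow> 'i \<Rightarrow> enat) \<Rightarrow> ('i \<times> bool) list set \<Rightarrow> 'i list \<Rightarrow> bool" where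
  "reduced_expr I m w is \<longleftrightarrow>
     is \<in> lists I \<and> coxeter_class I m is = w \<and> length is = coxeter_length I m w"

text \<open>\<open>T\<^sub>w\<close>; by Matsumoto's theorem the choice of the reduced expression is irrelevant.\<close>

definition artin_lift ::
  "'i set \<Rightarrow> ('i \<Rightarrow> 'i \<Rightarrow> enat) \<Rightarrow> ('i \<times> bool) list set \<Rightarrow> 'i list set" where
  "artin_lift I m w = artin_class I m (SOME is. reduced_expr I m w is)"

definition hecke_rels :: "'i set \<Rightarrow> ('i \<Rightarrow> 'i \<Rightarrow> enat) \<Rightarrow> ('i list \<times> 'i list) set" where
  "hecke_rels I m = braid_rels I m \<union> {([i, i], [i]) | i. i \<in> I}"

definition hecke_presented :: "'i set \<Rightarrow> ('i \<Rightarrow> 'i \<Rightarrow> enat) \<Rightarrow> 'i list set monoid" where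
  "hecke_presented I m = presented_monoid I (hecke_rels I m)"

text \<open>The identification of the underlying set of the Coxeter group with the monoid presented by
  the Hecke relations, \<open>w = s\<^sub>i\<^sub>1 \<cdots> s\<^sub>i\<^sub>k\<close> (reduced) going to \<open>s\<^sub>i\<^sub>1 \<star> \<cdots> \<star> s\<^sub>i\<^sub>k\<close>. This is the unique map
  fixing the identity and with \<open>s\<^sub>i \<star> w = s\<^sub>i w\<close> whenever \<open>\<ell> (s\<^sub>i w) > \<ell> w\<close>; it is bijective and
  independent of the choice of reduced expressions.\<close>

definition hecke_ident ::
  "'i set \<Rightarrow> ('i \<Rightarrow> 'i \<Rightarrow> enat) \<Rightarrow> ('i \<times> bool) list set \<Rightarrow> 'i list set" where
  "hecke_ident I m w = word_class I (hecke_rels I m) (SOME is. reduced_expr I m w is)"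

text \<open>\<open>(W, \<star>)\<close>: the presented Hecke monoid, transported to the set \<open>W\<close> along this bijection.\<close>

definition hecke_monoid ::
  "'i set \<Rightarrow> ('i \<Rightarrow> 'i \<Rightarrow> enat) \<Rightarrow> ('i \<times> bool) list set monoid" where
  "hecke_monoid I m =
     \<lparr>carrier = carrier (coxeter_group I m),
      mult = (\<lambda>u v. inv_into (carrier (coxeter_group I m)) (hecke_ident I m)
                      (hecke_ident I m u \<otimes>\<^bsub>hecke_presented I m\<^esub> hecke_ident I m v)),
      one = \<one>\<^bsub>coxeter_group I m\<^esub>\<rparr>"

section \<open>Parabolic subgroups and longest elements\<close>

definition parabolic ::
  "'i set \<Rightarrow> ('i \<Rightarrow> 'i \<Rightarrow> enat) \<Rightarrow> 'i set \<Rightarrow> ('i \<times> bool) list set set" where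
  "parabolic I m J = generate (coxeter_group I m) (coxeter_gen I m ` J)"

definition finite_type :: "'i set \<Rightarrow> ('i \<Rightarrow> 'i \<Rightarrow> enat) \<Rightarrow> 'i set \<Rightarrow> bool" where
  "finite_type I m J \<longleftrightarrow> J \<subseteq> I \<and> finite (parabolic I m J)"

definition longest_elt ::
  "'i set \<Rightarrow> ('i \<Rightarrow> 'i \<Rightarrow> enat) \<Rightarrow> 'i set \<Rightarrow> ('i \<times> bool) list set" where
  "longest_elt I m J =
     (THE w. w \<in> parabolic I m J \<and>
             (\<forall>v\<in>parabolic I m J. coxeter_length I m v \<le> coxeter_length I m w))"

end

theory Submission
  imports Defs Complex_Main
begin

text \<open>The braid relations between words \<open>r\<^sub>i\<close> for the longest elements hold in the Artin monoid,
  hence in its quotients, the Coxeter group and the Hecke monoid; what is left is that \<open>r\<^sub>i\<close> is an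
  involution in the former and an idempotent in the latter.

  This, and the bijectivity of \<open>hecke_ident\<close>, rest on the combinatorics of Coxeter groups. Counting
  modulo 2 how often a reflection occurs along a word gives the exchange condition; the geometric
  representation shows that \<open>s\<^sub>i s\<^sub>j\<close> has order exactly \<open>m\<^sub>i\<^sub>j\<close>. By exchange, an element whose
  left descents include \<open>J\<close> has a reduced word beginning with any given reduced word over \<open>J\<close>, and
  is therefore unique in its coset of \<open>W\<^sub>J\<close>. For \<open>|J| = 2\<close> this yields Matsumoto's theorem and the
  braid relations for the operators \<open>w \<mapsto> s\<^sub>i \<star> w\<close>; for \<open>J\<close> of finite type it yields the properties
  of the longest element.\<close>

section \<open>Presented monoids\<close>

text \<open>Reduced words are chosen by \<open>SOME\<close>, and \<open>\<Phi>\<close> sees the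
  chosen word \<open>r i\<close> of a longest element only through its Artin class; nothing says at
  the outset that its letters lie in \<open>J i\<close>. The product of \<open>hecke_monoid\<close>
  is read back through \<open>inv_into\<close>, so it is meaningful only once
  \<open>hecke_ident\<close> is a bijection: surjectivity and injectivity come from an action of the
  Hecke monoid on words, with Matsumoto's theorem linking the action to the relations. The
  presentation alone bounds the order of a product of two generators from above only. The lower
  bound needs a representation, and this rank-two fact is the sole use of geometry: no roots or
  positivity occur, because exchange comes from counting. Since the generators are involutions, the
  theory runs on unsigned words, with reversal as inversion. Two notions of reducedness must be kept
  apart, over a subset \<open>J\<close> and over all letters.\<close>

declare in_lists_conv_set [simp del] in_listsI [rule del] in_listsD [rule del]
  append_in_lists_conv [simp]

lemma lists_rev: "u \<in> lists J \<Longrightarrow> rev u \<in> lists J"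
  by (simp add: lists_eq_set)

lemma word_cong_in_lists:
  "word_cong X R u v \<Longrightarrow> u \<in> lists X \<and> v \<in> lists X"
  by (induction rule: word_cong.induct) auto

lemma word_cong_relI:
  assumes "(u, v) \<in> R" "u \<in> lists X" "v \<in> lists X" shows "word_cong X R u v"
  using word_cong.rel[OF assms, of "[]" "[]"] by simp

lemma word_cong_context:
  assumes "word_cong X R u v" "a \<in> lists X" "b \<in> lists X"
  shows "word_cong X R (a @ u @ b) (a @ v @ b)"
  using assms
proof (induction rule: word_cong.induct)
  case (rel u v c d)
  then have "word_cong X R ((a @ c) @ u @ (d @ b)) ((a @ c) @ v @ (d @ b))"
    by (intro word_cong.rel) auto
  then show ?case by simp
next
  case (refl w)
  then show ?case by (intro word_cong.refl) simp
qed (auto intro: word_cong.sym word_cong.trans)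

lemma word_cong_append:
  assumes "word_cong X R u u'" "word_cong X R v v'"
  shows "word_cong X R (u @ v) (u' @ v')"
proof -
  have "word_cong X R ([] @ u @ v) ([] @ u' @ v)"
    using assms(1) word_cong_in_lists[OF assms(2)] by (intro word_cong_context) auto
  moreover have "word_cong X R (u' @ v @ []) (u' @ v' @ [])"
    using assms(2) word_cong_in_lists[OF assms(1)] by (intro word_cong_context) auto
  ultimately show ?thesis using word_cong.trans by fastforce
qed

lemma concat_map_in_lists:
  "(\<And>x. x \<in> X \<Longrightarrow> f x \<in> lists Y) \<Longrightarrow> w \<in> lists X \<Longrightarrow> concat (map f w) \<in> lists Y"
  by (induction w) auto

text \<open>A substitution of words for letters need only be tested on the defining relations. The
  homomorphisms, the retraction \<open>keep\<close> and the passage to and from signed words all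
  rest on this.\<close>

lemma word_cong_concat_map:
  assumes "word_cong X R u v"
    and f: "\<And>x. x \<in> X \<Longrightarrow> f x \<in> lists Y"
    and R: "\<And>u v. (u, v) \<in> R \<Longrightarrow> u \<in> lists X \<Longrightarrow> v \<in> lists X
              \<Longrightarrow> word_cong Y S (concat (map f u)) (concat (map f v))"
  shows "word_cong Y S (concat (map f u)) (concat (map f v))"
  using assms(1)
proof (induction rule: word_cong.induct)
  case (rel u v a b)
  then show ?case
    using word_cong_context[OF R[of u v], of "concat (map f a)" "concat (map f b)"]
      concat_map_in_lists[of X f Y] f by simp
next
  case (refl w)
  then show ?case using concat_map_in_lists[of X f Y] f by (auto intro: word_cong.refl)
qed (auto intro: word_cong.sym word_cong.trans)

lemma word_class_eq_iff:
  assumes "u \<in> lists X"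
  shows "word_class X R u = word_class X R v \<longleftrightarrow> word_cong X R u v"
proof
  assume "word_class X R u = word_class X R v"
  moreover have "u \<in> word_class X R u"
    using assms by (simp add: word_class_def word_cong.refl)
  ultimately show "word_cong X R u v"
    by (auto simp: word_class_def intro: word_cong.sym)
next
  assume "word_cong X R u v"
  then show "word_class X R u = word_class X R v"
    by (auto simp: word_class_def intro: word_cong.sym word_cong.trans)
qed

lemma presented_monoid_mult:
  assumes "u \<in> lists X" "v \<in> lists X"
  shows "word_class X R u \<otimes>\<^bsub>presented_monoid X R\<^esub> word_class X R v = word_class X R (u @ v)"
proof -
  have "word_class X R (a @ b) = word_class X R (u @ v)"
    if "a \<in> word_class X R u" "b \<in> word_class X R v" for a b
  proof -
    have "word_cong X R (u @ v) (a @ b)"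
      using that by (intro word_cong_append) (auto simp: word_class_def)
    then show ?thesis using assms by (subst eq_commute, subst word_class_eq_iff) auto
  qed
  moreover have "u \<in> word_class X R u" "v \<in> word_class X R v"
    using assms by (auto simp: word_class_def intro: word_cong.refl)
  ultimately have "(\<Union>a\<in>word_class X R u. \<Union>b\<in>word_class X R v. word_class X R (a @ b)) =
      word_class X R (u @ v)"
    by fast
  then show ?thesis by (simp add: presented_monoid_def)
qed

lemma presented_monoid_carrier: "carrier (presented_monoid X R) = word_class X R ` lists X"
  by (simp add: presented_monoid_def)

lemma presented_monoid_one: "\<one>\<^bsub>presented_monoid X R\<^esub> = word_class X R []"
  by (simp add: presented_monoid_def)

lemma monoid_presented_monoid: "monoid (presented_monoid X R)"
proof (rule monoidI)
  fix x y z
  assume "x \<in> carrier (presented_monoid X R)" "y \<in> carrier (presented_monoid X R)"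
    "z \<in> carrier (presented_monoid X R)"
  then show "x \<otimes>\<^bsub>presented_monoid X R\<^esub> y \<otimes>\<^bsub>presented_monoid X R\<^esub> z =
      x \<otimes>\<^bsub>presented_monoid X R\<^esub> (y \<otimes>\<^bsub>presented_monoid X R\<^esub> z)"
    by (auto simp: presented_monoid_carrier presented_monoid_mult)
qed (auto simp: presented_monoid_carrier presented_monoid_one presented_monoid_mult)

text \<open>Universal property of a presentation, on the level of words: generators may go to
  arbitrary words, and the representative picked from a class does not matter because
  \<open>f\<close> respects the relations.\<close>

lemma presented_monoid_hom:
  assumes f: "\<And>x. x \<in> X \<Longrightarrow> f x \<in> lists Y"
    and R: "\<And>u v. (u, v) \<in> R \<Longrightarrow> u \<in> lists X \<Longrightarrow> v \<in> lists X
              \<Longrightarrow> word_cong Y S (concat (map f u)) (concat (map f v))"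
  shows "\<exists>h \<in> monoid_hom (presented_monoid X R) (presented_monoid Y S).
    \<forall>w\<in>lists X. h (word_class X R w) = word_class Y S (concat (map f w))"
proof (intro bexI ballI)
  define h where "h A = word_class Y S (concat (map f (SOME w. w \<in> A)))" for A
  show h: "h (word_class X R w) = word_class Y S (concat (map f w))" if "w \<in> lists X" for w
  proof -
    have "w \<in> word_class X R w"
      using that by (auto simp: word_class_def intro: word_cong.refl)
    then have "(SOME v. v \<in> word_class X R w) \<in> word_class X R w"
      by (rule someI)
    then have "word_cong X R w (SOME v. v \<in> word_class X R w)"
      by (simp add: word_class_def)
    then have "word_cong Y S (concat (map f w)) (concat (map f (SOME v. v \<in> word_class X R w)))"
      using assms by (rule word_cong_concat_map)
    then show ?thesis
      unfolding h_def using word_cong_in_lists word_class_eq_iff by metis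
  qed
  have fl: "concat (map f w) \<in> lists Y" if "w \<in> lists X" for w
    using f that by (rule concat_map_in_lists)
  show "h \<in> monoid_hom (presented_monoid X R) (presented_monoid Y S)"
    unfolding monoid_hom_def hom_def
    using h fl
    by (auto simp: presented_monoid_carrier presented_monoid_one presented_monoid_mult)
qed

section \<open>Alternating words\<close>

lemma length_alt_word [simp]: "length (alt_word n i j) = n"
  by (induction n arbitrary: i j) auto

lemma set_alt_word: "set (alt_word n i j) \<subseteq> {i, j}"
  by (induction n arbitrary: i j) auto

lemma alt_word_snoc: "alt_word (Suc n) i j = alt_word n i j @ [if even n then i else j]"
  by (induction n arbitrary: i j) auto

lemma alt_word_add:
  "alt_word (k + n) i j = alt_word k i j @ (if even k then alt_word n i j else alt_word n j i)"
  by (induction k arbitrary: i j) auto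

lemma rev_alt_word: "rev (alt_word n i j) = (if even n then alt_word n j i else alt_word n i j)"
proof (induction n arbitrary: i j)
  case (Suc n)
  have "rev (alt_word (Suc n) i j) = rev (alt_word n j i) @ [i]" by simp
  also have "\<dots> = (if even (Suc n) then alt_word (Suc n) j i else alt_word (Suc n) i j)"
    unfolding Suc.IH alt_word_snoc by simp
  finally show ?case .
qed simp

text \<open>Splits a Coxeter relator in the middle. With reversal as inversion, its triviality
  becomes the braid relation, and conversely.\<close>

lemma alt_word_double: "alt_word (2 * n) i j = alt_word n i j @ rev (alt_word n j i)"
  using alt_word_add[of n n i j] by (simp add: rev_alt_word mult_2)

section \<open>Words modulo the Coxeter relations\<close>

locale coxeter =
  fixes m :: "'i \<Rightarrow> 'i \<Rightarrow> enat"
  assumes m_diag: "m i i = 1"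
    and m_sym: "m i j = m j i"
    and m_ge: "i \<noteq> j \<Longrightarrow> 2 \<le> m i j"
begin

text \<open>Unsigned words suffice: \<open>m i i = 1\<close> makes \<open>[i, i]\<close> a relator,
  so each generator is its own inverse.\<close>

definition word_rels :: "('i list \<times> 'i list) set" where
  "word_rels = {(alt_word (2 * n) i j, []) | n i j. m i j = enat n}"

abbreviation ceq :: "'i list \<Rightarrow> 'i list \<Rightarrow> bool" (infix "\<approx>" 50) where
  "u \<approx> v \<equiv> word_cong UNIV word_rels u v"

lemma ceq_refl [simp, intro]: "u \<approx> u"
  by (simp add: word_cong.refl)

lemmas ceq_sym = word_cong.sym[of UNIV word_rels]
lemmas ceq_trans [trans] = word_cong.trans[of UNIV word_rels]
lemmas ceq_append = word_cong_append[of UNIV word_rels]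

lemma ceq_left: "u \<approx> v \<Longrightarrow> a @ u \<approx> a @ v"
  by (simp add: ceq_append)

lemma ceq_right: "u \<approx> v \<Longrightarrow> u @ b \<approx> v @ b"
  by (simp add: ceq_append)

lemma ceq_Cons: "u \<approx> v \<Longrightarrow> i # u \<approx> i # v"
  using ceq_left[of u v "[i]"] by simp

lemma ceq_rel: "m i j = enat n \<Longrightarrow> alt_word (2 * n) i j \<approx> []"
  using word_cong.rel[of "alt_word (2 * n) i j" "[]" word_rels UNIV "[]" "[]"]
  by (auto simp: word_rels_def)

lemma ceq_square: "[i, i] \<approx> []"
  using ceq_rel[of i i 1] by (simp add: m_diag one_enat_def numeral_2_eq_2)

lemma ceq_cancel2: "i # i # u \<approx> u"
  using ceq_right[OF ceq_square, of i u] by simp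

lemma ceq_cancel2_mid: "a @ i # i # u \<approx> a @ u"
  by (intro ceq_left ceq_cancel2)

lemma ceq_rev_left: "rev u @ u \<approx> []"
proof (induction u)
  case (Cons i u)
  have "rev (i # u) @ i # u \<approx> rev u @ u"
    using ceq_cancel2_mid by simp
  then show ?case using Cons ceq_trans by blast
qed simp

lemma ceq_rev_right: "u @ rev u \<approx> []"
  using ceq_rev_left[of "rev u"] by simp

lemma ceq_Cons_move: "i # u \<approx> v \<longleftrightarrow> u \<approx> i # v"
  by (meson ceq_Cons ceq_cancel2 ceq_sym ceq_trans)

lemma ceq_move: "a @ u \<approx> v \<longleftrightarrow> u \<approx> rev a @ v"
  by (induction a arbitrary: u v) (auto simp: ceq_Cons_move)

lemma ceq_cancel_left: "a @ u \<approx> a @ v \<longleftrightarrow> u \<approx> v"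
proof -
  have "rev a @ a @ v \<approx> v" using ceq_right[OF ceq_rev_left, of a v] by simp
  then show ?thesis using ceq_trans[of u "rev a @ a @ v" v] ceq_move[of a u "a @ v"] ceq_left by blast
qed

lemma ceq_Cons_cancel: "i # u \<approx> i # v \<longleftrightarrow> u \<approx> v"
  using ceq_cancel_left[of "[i]"] by simp

lemma ceq_rev:
  assumes "u \<approx> v" shows "rev u \<approx> rev v"
proof -
  have "u @ rev v \<approx> []" using ceq_right[OF assms] ceq_rev_right ceq_trans by blast
  then show ?thesis using ceq_move[of u "rev v" "[]"] by (auto intro: ceq_sym)
qed

lemma ceq_rev_iff: "rev u \<approx> rev v \<longleftrightarrow> u \<approx> v"
  using ceq_rev[of u v] ceq_rev[of "rev u" "rev v"] unfolding rev_rev_ident by blast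

lemma ceq_snoc_move: "u @ [i] \<approx> v \<longleftrightarrow> u \<approx> v @ [i]"
proof -
  have "u @ [i] \<approx> v \<longleftrightarrow> i # rev u \<approx> rev v"
    using ceq_rev_iff[of "u @ [i]" v] by simp
  also have "\<dots> \<longleftrightarrow> u \<approx> v @ [i]"
    using ceq_rev_iff[of u "v @ [i]"] by (simp add: ceq_Cons_move)
  finally show ?thesis .
qed

text \<open>All relators have even length, so there is a sign character; hence multiplication by a
  letter always changes the length.\<close>

lemma ceq_parity: "u \<approx> v \<Longrightarrow> even (length u) = even (length v)"
  by (induction rule: word_cong.induct) (auto simp: word_rels_def)

lemma ceq_braid:
  assumes "m i j = enat n" shows "alt_word n i j \<approx> alt_word n j i"
proof -
  have "alt_word n i j @ rev (alt_word n j i) \<approx> []"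
    using ceq_rel[OF assms] by (simp add: alt_word_double)
  from ceq_rev[OF this] have "alt_word n j i @ rev (alt_word n i j) \<approx> []" by simp
  then have "rev (alt_word n i j) \<approx> rev (alt_word n j i)" by (simp add: ceq_move)
  from ceq_rev[OF this] show ?thesis by simp
qed

subsection \<open>Length\<close>

definition len :: "'i list \<Rightarrow> nat" where
  "len u = (LEAST n. \<exists>v. u \<approx> v \<and> length v = n)"

lemma len_le: "u \<approx> v \<Longrightarrow> len u \<le> length v"
  unfolding len_def by (rule Least_le) blast

lemma len_word: obtains v where "u \<approx> v" "length v = len u"
proof -
  have "\<exists>v. u \<approx> v \<and> length v = len u"
    unfolding len_def by (rule LeastI[of _ "length u"]) blast
  then show ?thesis using that by blast
qed

lemma len_cong: "u \<approx> v \<Longrightarrow> len u = len v"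
  by (metis ceq_sym ceq_trans le_antisym len_le len_word)

lemma len_Nil [simp]: "len [] = 0"
  using len_le[of "[]" "[]"] by simp

lemma len_append_le: "len (u @ v) \<le> length u + len v"
proof -
  obtain w where "v \<approx> w" "length w = len v" by (rule len_word)
  then show ?thesis using len_le[of "u @ v" "u @ w"] ceq_left by simp
qed

lemma len_rev: "len (rev u) = len u"
proof -
  have "len (rev u) \<le> len u" for u
    by (metis ceq_rev len_le len_word length_rev)
  from this[of u] this[of "rev u"] show ?thesis by simp
qed

lemma len_parity: "even (len u) = even (length u)"
  by (metis ceq_parity len_word)

lemma len_Cons_le: "len (i # u) \<le> Suc (len u)"
  using len_append_le[of "[i]" u] by simp

lemma len_le_Cons: "len u \<le> Suc (len (i # u))"
  using len_Cons_le[of i "i # u"] len_cong[OF ceq_cancel2] by simp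

lemma len_Cons_neq: "len (i # u) \<noteq> len u"
  using len_parity[of u] len_parity[of "i # u"] by auto

lemma not_descent: "\<not> len (i # u) < len u \<longleftrightarrow> len (i # u) = Suc (len u)"
  using len_Cons_neq[of i u] len_Cons_le[of i u] by auto

lemma descent: "len (i # u) < len u \<longleftrightarrow> len u = Suc (len (i # u))"
  using len_le_Cons[of u i] by auto

definition red :: "'i list \<Rightarrow> bool" where
  "red u \<longleftrightarrow> len u = length u"

lemma redI_ceq: "u \<approx> v \<Longrightarrow> length u = len v \<Longrightarrow> red u"
  by (simp add: red_def len_cong)

lemma red_tail: "red (i # u) \<Longrightarrow> red u"
  using len_Cons_le[of i u] len_le[of u u] by (simp add: red_def)

lemma descent_word:
  assumes "len (i # u) < len u"
  obtains v where "i # v \<approx> u" "red (i # v)" "red v" "len v < len (i # v)"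
proof -
  obtain v where v: "i # u \<approx> v" "length v = len (i # u)" by (rule len_word)
  then have *: "i # v \<approx> u" using ceq_Cons_move ceq_sym by blast
  moreover have "red (i # v)"
    using * assms v(2) descent by (intro redI_ceq[of _ u]) auto
  moreover have "red v" using calculation(2) by (rule red_tail)
  ultimately show ?thesis using that by (auto simp: red_def)
qed

subsection \<open>The exchange condition\<close>

text \<open>The number of prefixes \<open>a @ [k]\<close> of the word such that the reflection \<open>a k a\<inverse>\<close> is \<open>t\<close>.
  Only its parity is an invariant of the group element.\<close>

primrec refl_count :: "'i list \<Rightarrow> 'i list \<Rightarrow> nat" where
  "refl_count [] t = 0"
| "refl_count (i # u) t = of_bool (t \<approx> [i]) + refl_count u ([i] @ t @ [i])"

lemma ceq_conj: "t \<approx> t' \<Longrightarrow> a @ t @ b \<approx> a @ t' @ b"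
  by (simp add: ceq_left ceq_right)

lemma ceq_conj_iff: "[i] @ t @ [i] \<approx> v \<longleftrightarrow> t \<approx> i # v @ [i]"
  by (simp add: ceq_Cons_move ceq_snoc_move)

lemma refl_count_cong: "t \<approx> t' \<Longrightarrow> refl_count u t = refl_count u t'"
proof (induction u arbitrary: t t')
  case (Cons i u)
  have "t \<approx> [i] \<longleftrightarrow> t' \<approx> [i]" using Cons.prems ceq_sym ceq_trans by blast
  then show ?case using Cons.IH[OF ceq_conj[OF Cons.prems, of "[i]" "[i]"]] by simp
qed simp

lemma refl_count_append: "refl_count (u @ v) t = refl_count u t + refl_count v (rev u @ t @ u)"
  by (induction u arbitrary: t) auto

text \<open>Conjugating the letter after the first \<open>k\<close> letters by those letters gives
  the palindrome \<open>alt_word (2 * k + 1) i j\<close>.\<close>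

lemma refl_count_alt_word:
  "refl_count (alt_word n i j) t = (\<Sum>k<n. of_bool (t \<approx> alt_word (2 * k + 1) i j))"
proof (induction n arbitrary: i j t)
  case (Suc n)
  have "i # alt_word (2 * k + 1) j i @ [i] = alt_word (2 * Suc k + 1) i j" for k
    using alt_word_snoc[of "2 * k + 2" i j] by simp
  then have "[i] @ t @ [i] \<approx> alt_word (2 * k + 1) j i \<longleftrightarrow> t \<approx> alt_word (2 * Suc k + 1) i j" for k
    by (metis ceq_conj_iff)
  then have "refl_count (alt_word (Suc n) i j) t =
      of_bool (t \<approx> [i]) + (\<Sum>k<n. of_bool (t \<approx> alt_word (2 * Suc k + 1) i j))"
    using Suc.IH[of j i "[i] @ t @ [i]"] by (simp del: append.simps)
  then show ?case by (subst sum.lessThan_Suc_shift) simp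
qed simp

text \<open>Along a relator the reflections number \<open>k\<close> and \<open>k + n\<close>
  coincide, since their words differ by the relator itself; every reflection is thus met an even
  number of times.\<close>

lemma even_refl_count_rel:
  assumes "m i j = enat n" shows "even (refl_count (alt_word (2 * n) i j) t)"
proof -
  have "alt_word (2 * (k + n) + 1) i j \<approx> alt_word (2 * k + 1) i j" for k
  proof -
    have "alt_word (2 * (k + n) + 1) i j = alt_word (2 * n) i j @ alt_word (2 * k + 1) i j"
      using alt_word_add[of "2 * n" "2 * k + 1" i j] by (simp add: algebra_simps)
    then show ?thesis using ceq_right[OF ceq_rel[OF assms], of "alt_word (2 * k + 1) i j"] by simp
  qed
  then have *: "t \<approx> alt_word (2 * (k + n) + 1) i j \<longleftrightarrow> t \<approx> alt_word (2 * k + 1) i j" for k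
    by (meson ceq_sym ceq_trans)
  have split: "(\<Sum>k<n + l. f k) = (\<Sum>k<n. f k) + (\<Sum>k<l. f (k + n))" for l and f :: "nat \<Rightarrow> nat"
    by (induction l) (auto simp: add.commute)
  show ?thesis
    unfolding refl_count_alt_word mult_2 split * [unfolded mult_2] by simp
qed

lemma refl_count_parity: "u \<approx> v \<Longrightarrow> even (refl_count u t) = even (refl_count v t)"
proof (induction rule: word_cong.induct)
  case (rel u v a b)
  then obtain n i j where uv: "u = alt_word (2 * n) i j" "v = []" "m i j = enat n"
    by (auto simp: word_rels_def)
  let ?s = "rev a @ t @ a"
  have "u \<approx> []" using uv ceq_rel by simp
  then have "rev u @ ?s @ u \<approx> ?s"
    using ceq_append[OF ceq_rev[of u "[]"] ceq_left[of u "[]" ?s]] by simp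
  then have "refl_count b (rev u @ ?s @ u) = refl_count b ?s" by (rule refl_count_cong)
  then show ?case using even_refl_count_rel[OF uv(3)] uv(1,2)
    by (simp add: refl_count_append)
qed auto

lemma refl_count_pos:
  "0 < refl_count u t \<Longrightarrow> \<exists>a k b. u = a @ k # b \<and> t @ a \<approx> a @ [k]"
proof (induction u arbitrary: t)
  case (Cons i u)
  show ?case
  proof (cases "t \<approx> [i]")
    case True
    then show ?thesis by (intro exI[of _ "[]"]) auto
  next
    case False
    with Cons.prems have "0 < refl_count u ([i] @ t @ [i])" by simp
    then obtain a k b where *: "u = a @ k # b" "([i] @ t @ [i]) @ a \<approx> a @ [k]"
      using Cons.IH by blast
    then have "t @ i # a \<approx> (i # a) @ [k]" by (simp add: ceq_Cons_move)
    with * show ?thesis by (intro exI[of _ "i # a"] exI[of _ k] exI[of _ b]) simp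
  qed
qed simp

lemma delete_letter:
  assumes "[i] @ a \<approx> a @ [k]" shows "i # a @ k # b \<approx> a @ b"
proof -
  have "i # a @ k # b \<approx> a @ k # k # b" using ceq_right[OF assms, of "k # b"] by simp
  also have "\<dots> \<approx> a @ b" by (rule ceq_cancel2_mid)
  finally show ?thesis .
qed

text \<open>Conjugation by \<open>i\<close> fixes the reflection \<open>i\<close>, so the counts of
  \<open>[i]\<close> along \<open>i # r\<close> and along \<open>r\<close> differ by one. Were the
  count along \<open>r\<close> even, it would be odd along a shortest word \<open>x\<close> for
  \<open>i # r\<close>, and deleting a letter of \<open>x\<close> would give a word for
  \<open>r\<close> shorter than \<open>len r\<close>. Hence it is odd, so positive, along
  \<open>r\<close> itself, which need not be reduced.\<close>

lemma exchange:
  assumes "len (i # r) < len r"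
  obtains a k b where "r = a @ k # b" "i # a \<approx> a @ [k]"
proof -
  have "odd (refl_count r [i])"
  proof
    assume ev: "even (refl_count r [i])"
    obtain x where x: "i # r \<approx> x" "length x = len (i # r)" by (rule len_word)
    have "[i] @ [i] @ [i] \<approx> [i]" using ceq_cancel2[of i "[i]"] by simp
    then have "refl_count r ([i] @ [i] @ [i]) = refl_count r [i]" by (rule refl_count_cong)
    then have "refl_count (i # r) [i] = 1 + refl_count r [i]"
      by simp
    with ev have "odd (refl_count x [i])" using refl_count_parity[OF x(1), of "[i]"] by simp
    then have "0 < refl_count x [i]" by (rule odd_pos)
    then obtain a k b where x': "x = a @ k # b" "[i] @ a \<approx> a @ [k]"
      using refl_count_pos by blast
    have "r \<approx> i # x" using x(1) by (simp add: ceq_Cons_move)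
    also have "i # x \<approx> a @ b" unfolding x'(1) by (rule delete_letter[OF x'(2)])
    finally have "len r \<le> length (a @ b)" by (rule len_le)
    with x(2) x'(1) assms show False by simp
  qed
  then have "0 < refl_count r [i]" by (rule odd_pos)
  then obtain a k b where "r = a @ k # b" "[i] @ a \<approx> a @ [k]"
    using refl_count_pos by blast
  then show ?thesis by (intro that) auto
qed


subsection \<open>The geometric representation\<close>

text \<open>The group acts on the dual of the geometric representation, whose elements are
  given by their values on the simple roots.\<close>

definition cartan :: "'i \<Rightarrow> 'i \<Rightarrow> real" where
  "cartan i j = (if i = j then 2 else case m i j of enat n \<Rightarrow> - 2 * cos (pi / n) | \<infinity> \<Rightarrow> - 2)"

text \<open>The contragredient reflection: \<open>f k\<close> is the value on the simple root
  \<alpha> with index \<open>k\<close>, and the new value is that of \<open>f\<close> on the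
  reflected root.\<close>

definition act :: "'i \<Rightarrow> ('i \<Rightarrow> real) \<Rightarrow> 'i \<Rightarrow> real" where
  "act i f = (\<lambda>k. f k - f i * cartan i k)"

lemma cartan_diag [simp]: "cartan i i = 2"
  by (simp add: cartan_def)

lemma cartan_sym: "cartan i j = cartan j i"
  by (simp add: cartan_def m_sym)

lemma act_act [simp]: "act i (act i f) = f"
  by (auto simp: act_def)

lemma foldr_alt_word_double: "foldr act (alt_word (2 * n) i j) f = ((act i \<circ> act j) ^^ n) f"
  by (induction n) auto

text \<open>The coefficients do not matter: when the two-by-two Cartan block is nonsingular, the
  values at \<open>i\<close> and \<open>j\<close> alone determine them.\<close>

lemma act_pair_span:
  "\<exists>A B. ((act i \<circ> act j) ^^ n) f = (\<lambda>k. f k - A * cartan i k - B * cartan j k)"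
proof (induction n)
  case 0
  show ?case by (intro exI[of _ 0]) simp
next
  case (Suc n)
  then obtain A B where AB: "((act i \<circ> act j) ^^ n) f = (\<lambda>k. f k - A * cartan i k - B * cartan j k)"
    by blast
  define g where "g = ((act i \<circ> act j) ^^ n) f"
  define x y where "x = act j g i" and "y = g j"
  have "((act i \<circ> act j) ^^ Suc n) f = (\<lambda>k. g k - y * cartan j k - x * cartan i k)"
    by (simp add: g_def x_def y_def act_def)
  also have "\<dots> = (\<lambda>k. f k - (A + x) * cartan i k - (B + y) * cartan j k)"
    by (simp add: AB[folded g_def] fun_eq_iff algebra_simps)
  finally have "((act i \<circ> act j) ^^ Suc n) f =
      (\<lambda>k. f k - (A + x) * cartan i k - (B + y) * cartan j k)" .
  then show ?case by blast
qed

text \<open>On the values at \<open>i\<close> and \<open>j\<close> the product has determinant 1 and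
  trace \<open>2 * cos (2 * \<theta>)\<close>, like a rotation by twice \<theta>, so its powers have
  sine quotients as entries. The factor \<open>sin \<theta>\<close> clears the denominators.\<close>

lemma act_pair_rotation:
  fixes \<theta> :: real and f :: "'i \<Rightarrow> real"
  assumes "cartan i j = - 2 * cos \<theta>"
  defines "F \<equiv> \<lambda>k::nat. ((act i \<circ> act j) ^^ k) f"
  shows "sin \<theta> * F k i = - (sin (2 * real k * \<theta>) * f j + sin (2 * real k * \<theta> - \<theta>) * f i) \<and>
    sin \<theta> * F k j = sin (2 * real k * \<theta> + \<theta>) * f j + sin (2 * real k * \<theta>) * f i"
proof (induction k)
  case 0
  show ?case by (simp add: F_def)
next
  case (Suc k)
  define c where "c = 2 * cos \<theta>"
  define x where "x = 2 * real k * \<theta>"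
  have sum: "sin (y + \<theta>) = c * sin y - sin (y - \<theta>)" for y
    by (simp add: c_def sin_add sin_diff)
  have x1: "2 * real (Suc k) * \<theta> = (x + \<theta>) + \<theta>" by (simp add: x_def algebra_simps)
  have cij: "cartan i j = - c" "cartan j i = - c" using assms cartan_sym by (auto simp: c_def)
  have FS: "F (Suc k) i = - F k i - c * F k j"
    "F (Suc k) j = c * F k i + (c * c - 1) * F k j"
    unfolding F_def using cij by (auto simp: act_def algebra_simps)
  have IH: "sin \<theta> * F k i = - (sin x * f j + sin (x - \<theta>) * f i)"
    "sin \<theta> * F k j = sin (x + \<theta>) * f j + sin x * f i"
    using Suc.IH by (auto simp: x_def)
  have s1: "sin (x + \<theta> + \<theta>) = c * sin (x + \<theta>) - sin x"
    using sum[of "x + \<theta>"] by (simp only: add_diff_cancel_right')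
  have s2: "sin (x + \<theta> + \<theta> + \<theta>) = c * sin (x + \<theta> + \<theta>) - sin (x + \<theta>)"
    using sum[of "x + \<theta> + \<theta>"] by (simp only: add_diff_cancel_right')
  have "sin \<theta> * F (Suc k) i = - (sin \<theta> * F k i) - c * (sin \<theta> * F k j)"
    unfolding FS by (simp add: algebra_simps)
  also have "\<dots> = - (sin (x + \<theta> + \<theta>) * f j + sin (x + \<theta>) * f i)"
    unfolding IH s1 sum[of x] by (simp add: algebra_simps)
  finally have A: "sin \<theta> * F (Suc k) i = - (sin (x + \<theta> + \<theta>) * f j + sin (x + \<theta>) * f i)" .
  have "sin \<theta> * F (Suc k) j = c * (sin \<theta> * F k i) + (c * c - 1) * (sin \<theta> * F k j)"
    unfolding FS by (simp add: algebra_simps)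
  also have "\<dots> = sin (x + \<theta> + \<theta> + \<theta>) * f j + sin (x + \<theta> + \<theta>) * f i"
    unfolding IH s2 s1 sum[of x] by (simp add: algebra_simps)
  finally show ?case using A unfolding x1 add_diff_cancel_right' by blast
qed

text \<open>After \<open>n\<close> steps the rotation is by \<open>2 * pi\<close>, so the values at
  \<open>i\<close> and \<open>j\<close> return. The coefficients of \<open>act_pair_span\<close>
  then solve a homogeneous system whose determinant is a multiple of the square of
  \<open>sin \<theta>\<close>, nonzero because \<open>n \<ge> 2\<close>.\<close>

lemma act_rel:
  assumes n: "m i j = enat n"
  shows "foldr act (alt_word (2 * n) i j) f = f"
proof (cases "i = j")
  case True
  then show ?thesis using n m_diag[of i]
    by (simp add: one_enat_def numeral_2_eq_2)
next
  case False
  define \<theta> where "\<theta> = pi / n"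
  have n2: "n \<ge> 2" using m_ge[OF False] n by (simp add: numeral_eq_enat)
  have c: "cartan i j = - 2 * cos \<theta>" "cartan j i = - 2 * cos \<theta>"
    using False n cartan_sym[of i j] by (auto simp: cartan_def \<theta>_def)
  have nth: "real n * \<theta> = pi" using n2 by (simp add: \<theta>_def)
  have s: "sin \<theta> > 0" unfolding \<theta>_def using n2
    by (intro sin_gt_zero) (auto simp: divide_less_eq)
  define F where "F = ((act i \<circ> act j) ^^ n) f"
  have 2: "2 * real n * \<theta> = 2 * pi" using nth by (simp add: algebra_simps)
  have "sin \<theta> * F i = sin \<theta> * f i" "sin \<theta> * F j = sin \<theta> * f j"
    using act_pair_rotation[OF c(1), of n f] unfolding F_def[symmetric] 2
    by (simp_all add: sin_diff sin_add)
  then have F: "F i = f i" "F j = f j" using s by auto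
  obtain A B where AB: "F = (\<lambda>k. f k - A * cartan i k - B * cartan j k)"
    using act_pair_span unfolding F_def by blast
  from F have "A = B * cos \<theta>" "B = A * cos \<theta>" by (auto simp: AB c)
  then have "A * (1 - (cos \<theta>)\<^sup>2) = 0" "B * (1 - (cos \<theta>)\<^sup>2) = 0"
    by (auto simp: power2_eq_square algebra_simps)
  then have "A * (sin \<theta>)\<^sup>2 = 0" "B * (sin \<theta>)\<^sup>2 = 0" by (simp_all add: sin_squared_eq)
  then have "F = f" using s by (simp add: AB)
  then show ?thesis by (simp add: foldr_alt_word_double F_def)
qed

lemma act_cong: "u \<approx> v \<Longrightarrow> foldr act u f = foldr act v f"
  by (induction arbitrary: f rule: word_cong.induct) (auto simp: word_rels_def act_rel)

lemma alt_word_order: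
  assumes "i \<noteq> j" "alt_word (2 * r) i j \<approx> []" "enat r < m i j"
  shows "r = 0"
proof (rule ccontr)
  assume r: "r \<noteq> 0"
  \<comment> \<open>This vector keeps one term of each rotation formula. For finite
    \<open>m i j\<close> triviality forces \<open>cos (2 * r * \<theta>) = 1\<close> although
    \<open>r * \<theta>\<close> lies strictly between 0 and \<open>pi\<close>; for infinite
    \<open>m i j\<close> the values grow linearly.\<close>
  define f :: "'i \<Rightarrow> real" where "f = (\<lambda>k. of_bool (k = j))"
  have f: "f i = 0" "f j = 1" using assms(1) by (auto simp: f_def)
  have id: "((act i \<circ> act j) ^^ r) f = f"
    using act_cong[OF assms(2), of f] by (simp add: foldr_alt_word_double)
  show False
  proof (cases "m i j")
    case (enat n)
    define \<theta> where "\<theta> = pi / n"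
    have rn: "r < n" using assms(3) enat by simp
    have n2: "n \<ge> 2" using m_ge[OF assms(1)] enat by (simp add: numeral_eq_enat)
    have c: "cartan i j = - 2 * cos \<theta>"
      using assms(1) enat by (auto simp: cartan_def \<theta>_def)
    have s: "sin \<theta> > 0" unfolding \<theta>_def using n2
      by (intro sin_gt_zero) (auto simp: divide_less_eq)
    have s': "sin (r * \<theta>) > 0"
    proof (rule sin_gt_zero)
      show "0 < r * \<theta>" using r n2 by (simp add: \<theta>_def)
      have "real r * pi < real n * pi" using rn by simp
      then show "r * \<theta> < pi" using n2 by (simp add: \<theta>_def divide_less_eq mult.commute)
    qed
    have "sin (2 * r * \<theta>) = 0" "sin (2 * r * \<theta> + \<theta>) = sin \<theta>"
      using act_pair_rotation[OF c, of r f] unfolding id f by auto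
    then have "cos (2 * r * \<theta>) = 1" using s by (simp add: sin_add)
    moreover have "cos (2 * r * \<theta>) = 1 - 2 * (sin (r * \<theta>))\<^sup>2"
      using cos_double_sin[of "r * \<theta>"] by (simp add: mult.assoc)
    ultimately show False using s' by simp
  next
    case infinity
    then have c: "cartan i j = - 2" "cartan j i = - 2"
      using assms(1) cartan_sym[of i j] by (auto simp: cartan_def)
    have "((act i \<circ> act j) ^^ k) f i = - 2 * real k \<and> ((act i \<circ> act j) ^^ k) f j = 2 * real k + 1" for k
    proof (induction k)
      case (Suc k)
      then show ?case by (simp add: act_def c algebra_simps)
    qed (simp add: f)
    from this[of r] show False using r by (simp add: id f)
  qed
qed

subsection \<open>Parabolic words\<close>

text \<open>Minimality is asked only among words over \<open>J\<close>: deleting a letter stays over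
  \<open>J\<close>, and it is not yet known that such a word is also shortest among all
  words.\<close>

definition red_in :: "'i set \<Rightarrow> 'i list \<Rightarrow> bool" where
  "red_in J u \<longleftrightarrow> u \<in> lists J \<and> (\<forall>v\<in>lists J. u \<approx> v \<longrightarrow> length u \<le> length v)"

lemma red_in_tail:
  assumes "red_in J (j # u)" shows "red_in J u"
  unfolding red_in_def
proof (intro conjI ballI impI)
  show "u \<in> lists J" using assms by (simp add: red_in_def)
  fix v assume v: "v \<in> lists J" "u \<approx> v"
  then have "j # v \<in> lists J" "j # u \<approx> j # v" using assms ceq_Cons by (auto simp: red_in_def)
  then have "length (j # u) \<le> length (j # v)" using assms unfolding red_in_def by blast
  then show "length u \<le> length v" by simp
qed

lemma red_in_rev:
  assumes "red_in J u" shows "red_in J (rev u)"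
  unfolding red_in_def
proof (intro conjI ballI impI)
  show "rev u \<in> lists J" using assms by (simp add: red_in_def lists_rev)
  fix v assume "v \<in> lists J" "rev u \<approx> v"
  then have "rev v \<in> lists J" "u \<approx> rev v" using ceq_rev[of "rev u" v] by (auto simp: lists_rev)
  then have "length u \<le> length (rev v)" using assms unfolding red_in_def by blast
  then show "length (rev u) \<le> length v" by simp
qed

lemma red_in_word:
  assumes "u \<in> lists J"
  obtains v where "red_in J v" "u \<approx> v"
proof -
  obtain v where v: "v \<in> lists J \<and> u \<approx> v"
    and min: "\<And>w. w \<in> lists J \<and> u \<approx> w \<Longrightarrow> length v \<le> length w"
    using assms ex_has_least_nat[of "\<lambda>v. v \<in> lists J \<and> u \<approx> v" u length]
    by blast
  have "red_in J v" unfolding red_in_def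
    using v min ceq_trans by blast
  then show ?thesis using that v by blast
qed

text \<open>Exchange peels the letters of \<open>u\<close> off a reduced word of \<open>z\<close>; a letter of the part already
  peeled off cannot be deleted, because \<open>u\<close> is reduced.\<close>

lemma descents_prefix:
  assumes "\<And>j. j \<in> J \<Longrightarrow> len (j # z) < len z" "red_in J u"
  obtains t where "u @ t \<approx> z" "length u + length t = len z"
proof -
  have "\<exists>t. u @ t \<approx> z \<and> length u + length t = len z"
    using assms(2)
  proof (induction u)
    case Nil
    obtain t where "z \<approx> t" "length t = len z" by (rule len_word)
    then show ?case using ceq_sym by auto
  next
    case (Cons j u)
    then obtain t where t: "u @ t \<approx> z" "length u + length t = len z"
      using red_in_tail by blast
    have jJ: "j \<in> J" and uJ: "u \<in> lists J" using Cons.prems by (auto simp: red_in_def)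
    have "len (j # u @ t) < len (u @ t)"
      using assms(1)[OF jJ] len_cong[OF t(1)] len_cong[OF ceq_Cons[OF t(1)]] by simp
    then obtain a k b where ex: "u @ t = a @ k # b" "j # a \<approx> a @ [k]" by (rule exchange)
    have "\<exists>d. a = u @ d \<and> t = d @ k # b"
    proof (rule ccontr)
      assume none: "\<not> ?thesis"
      obtain us where us: "u = a @ us" "us @ t = k # b"
        using ex(1) none unfolding append_eq_append_conv2 by metis
      moreover have "us \<noteq> []" using us none by auto
      ultimately obtain c where c: "u = a @ k # c" by (cases us) auto
      have "j # a @ k # c \<approx> a @ c" using ex(2) by (intro delete_letter) simp
      then have "j # u \<approx> a @ c" by (simp add: c)
      moreover have "a @ c \<in> lists J" using uJ by (simp add: c)
      ultimately have "length (j # u) \<le> length (a @ c)" using Cons.prems by (auto simp: red_in_def)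
      then show False by (simp add: c)
    qed
    then obtain d where d: "a = u @ d" "t = d @ k # b" by blast
    have "j # a @ k # b \<approx> a @ b" using ex(2) by (intro delete_letter) simp
    then have "a @ k # b \<approx> j # a @ b" by (simp add: ceq_Cons_move)
    from ceq_trans[OF ceq_sym[OF this], of z] have "(j # u) @ d @ b \<approx> z"
      using t(1) ex(1) d(1) by simp
    then show ?case using t(2) d(2) by (intro exI[of _ "d @ b"]) simp
  qed
  then show ?thesis using that by blast
qed

text \<open>Write \<open>z'\<close> as \<open>v @ z\<close> with \<open>v\<close> reduced over
  \<open>J\<close>. As \<open>z\<close> begins with \<open>rev v\<close> and \<open>z'\<close>
  begins with \<open>v\<close>, each of the two is shorter than the other by
  \<open>length v\<close>, so \<open>v\<close> is empty.\<close>

lemma descents_unique: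
  assumes "\<And>j. j \<in> J \<Longrightarrow> len (j # z) < len z" "\<And>j. j \<in> J \<Longrightarrow> len (j # z') < len z'"
    and "u \<in> lists J" "z' \<approx> u @ z"
  shows "z' \<approx> z"
proof -
  obtain v where v: "red_in J v" "u \<approx> v" using assms(3) by (rule red_in_word)
  have z': "z' \<approx> v @ z" using assms(4) ceq_right[OF v(2)] by (rule ceq_trans)
  obtain t where t: "rev v @ t \<approx> z" "length (rev v) + length t = len z"
    using assms(1) red_in_rev[OF v(1)] by (rule descents_prefix)
  obtain t' where t': "v @ t' \<approx> z'" "length v + length t' = len z'"
    using assms(2) v(1) by (rule descents_prefix)
  have "t \<approx> v @ z" using t(1) ceq_move[of "rev v"] by simp
  then have "len z' \<le> length t" using z' by (intro len_le) (blast intro: ceq_sym ceq_trans)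
  moreover have "v @ t' \<approx> v @ z" using t'(1) z' by (rule ceq_trans)
  then have "len z \<le> length t'" unfolding ceq_cancel_left by (rule len_le[OF ceq_sym])
  ultimately have "length v = 0" using t(2) t'(2) unfolding length_rev by linarith
  then show ?thesis using z' by simp
qed

text \<open>A letter put before an alternating word either prolongs it or cancels its first
  letter.\<close>

lemma dihedral_word:
  assumes "v \<in> lists {i, j}"
  shows "\<exists>k\<le>length v. v \<approx> alt_word k i j \<or> v \<approx> alt_word k j i"
  using assms
proof (induction v)
  case (Cons a v)
  then obtain k where k: "k \<le> length v" "v \<approx> alt_word k i j \<or> v \<approx> alt_word k j i"
    by auto
  have step: "\<exists>k\<le>length (a # v). a # v \<approx> alt_word k x y \<or> a # v \<approx> alt_word k y x"
    if k: "k \<le> length v" "v \<approx> alt_word k x y" and "a = x \<or> a = y" for k x y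
    using that(3)
  proof
    assume "a = y"
    then have "a # v \<approx> alt_word (Suc k) y x" using ceq_Cons[OF k(2)] by simp
    then show ?thesis using k(1) by (intro exI[of _ "Suc k"]) simp
  next
    assume a: "a = x"
    show ?thesis
    proof (cases k)
      case 0
      then have "a # v \<approx> alt_word 1 x y" using ceq_Cons[OF k(2)] a by simp
      then show ?thesis by (intro exI[of _ 1]) simp
    next
      case (Suc l)
      then have "a # v \<approx> alt_word l y x"
        using ceq_Cons[OF k(2), of x] ceq_cancel2[of x "alt_word l y x"] a
        by (auto intro: ceq_trans)
      then show ?thesis using Suc k(1) by (intro exI[of _ l]) simp
    qed
  qed
  have "a = i \<or> a = j" using Cons.hyps(1) by simp
  then show ?case using k step[of k i j] step[of k j i] by blast
qed auto

text \<open>A shorter word could be taken alternating, of length \<open>k < n\<close> and of the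
  same parity. Comparing the two gives a trivial alternating word of length \<open>n - k\<close> or
  \<open>n + k\<close>, that is, a power of a product of the two generators with positive exponent
  below \<open>n\<close>, which \<open>alt_word_order\<close> excludes.\<close>

lemma red_in_alt_word:
  assumes "i \<noteq> j" "enat n \<le> m i j"
  shows "red_in {i, j} (alt_word n i j)"
  unfolding red_in_def
proof (intro conjI ballI impI)
  show "alt_word n i j \<in> lists {i, j}" using set_alt_word[of n i j] by (auto simp: lists_eq_set)
  fix v assume "v \<in> lists {i, j}" and v: "alt_word n i j \<approx> v"
  then obtain k where k: "k \<le> length v" "v \<approx> alt_word k i j \<or> v \<approx> alt_word k j i"
    using dihedral_word by blast
  show "length (alt_word n i j) \<le> length v"
  proof (rule ccontr)
    assume "\<not> ?thesis"
    then have kn: "k < n" using k(1) by simp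
    have eq: "alt_word n i j \<approx> alt_word k i j \<or> alt_word n i j \<approx> alt_word k j i"
      using v k(2) ceq_trans by blast
    have ord: "r = 0" if "alt_word (2 * r) x y \<approx> []" "{x, y} = {i, j}" "r < n" for r x y
    proof (rule alt_word_order)
      show "x \<noteq> y" using that(2) assms(1) by auto
      have "m x y = m i j" using that(2) m_sym by (auto simp: doubleton_eq_iff)
      moreover have "enat r < enat n" using that(3) by simp
      ultimately show "enat r < m x y" using order.strict_trans2[of "enat r" "enat n" "m i j"] assms(2) by simp
    qed (use that in simp)
    from eq have par: "even n \<longleftrightarrow> even k" using ceq_parity by fastforce
    from eq show False
    proof
      assume e: "alt_word n i j \<approx> alt_word k i j"
      have "alt_word n i j = alt_word k i j @ (if even k then alt_word (n - k) i j else alt_word (n - k) j i)"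
        using alt_word_add[of k "n - k" i j] kn by simp
      with e have "alt_word k i j @ (if even k then alt_word (n - k) i j else alt_word (n - k) j i)
          \<approx> alt_word k i j @ []" by simp
      then have *: "(if even k then alt_word (n - k) i j else alt_word (n - k) j i) \<approx> []"
        unfolding ceq_cancel_left .
      have "even (n - k)" using par kn by simp
      then obtain r where r: "n - k = 2 * r" by (rule evenE)
      then have "r = 0" using * ord[of r i j] ord[of r j i] kn
        by (auto split: if_splits simp: insert_commute)
      then show False using r kn by simp
    next
      assume "alt_word n i j \<approx> alt_word k j i"
      then have "rev (alt_word k j i) @ alt_word n i j \<approx> []"
        using ceq_move[of "rev (alt_word k j i)" "alt_word n i j" "[]"] by simp
      moreover have "rev (alt_word k j i) @ alt_word n i j =
          (if even k then alt_word (k + n) i j else alt_word (k + n) j i)"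
        by (simp add: rev_alt_word alt_word_add)
      ultimately have *: "(if even k then alt_word (k + n) i j else alt_word (k + n) j i) \<approx> []"
        by simp
      have "even (k + n)" using par by simp
      then obtain r where r: "k + n = 2 * r" by (rule evenE)
      then have "r = 0" using * ord[of r i j] ord[of r j i] kn
        by (auto split: if_splits simp: insert_commute)
      then show False using r kn by simp
    qed
  qed
qed


subsection \<open>Matsumoto's theorem\<close>

abbreviation beq :: "'i list \<Rightarrow> 'i list \<Rightarrow> bool" where
  "beq \<equiv> word_cong UNIV (braid_rels UNIV m)"

lemma beq_Cons: "beq u v \<Longrightarrow> beq (i # u) (i # v)"
  using word_cong_append[of UNIV "braid_rels UNIV m" "[i]" "[i]" u v] by (simp add: word_cong.refl)

lemma beq_alt_word:
  assumes "i \<noteq> j" "m i j = enat n" shows "beq (alt_word n i j @ t) (alt_word n j i @ t)"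
  using word_cong.rel[of "alt_word n i j" "alt_word n j i" "braid_rels UNIV m" UNIV "[]" t] assms
  by (auto simp: braid_rels_def)

text \<open>If the first letters \<open>i\<close> and \<open>j\<close> differ, both are descents, so
  the element begins with the alternating word of length \<open>m i j\<close>, started with either
  letter. By induction the tails of \<open>u\<close> and \<open>v\<close> are braid equivalent to
  the tails of these two expressions, which differ by a single braid move.\<close>

theorem matsumoto:
  assumes "red u" "red v" "u \<approx> v" shows "beq u v"
  using assms
proof (induction "length u" arbitrary: u v rule: less_induct)
  case less
  have lenv: "length v = length u" using less.prems len_cong by (simp add: red_def)
  show ?case
  proof (cases u)
    case Nil
    then show ?thesis using lenv by (simp add: word_cong.refl)
  next
    case u: (Cons i u')
    then obtain j v' where v: "v = j # v'" using lenv by (cases v) auto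
    have red': "red u'" "red v'" using less.prems red_tail by (auto simp: u v)
    have lenv': "length v' < length u" using lenv v by simp
    show ?thesis
    proof (cases "i = j")
      case True
      then have "u' \<approx> v'" using less.prems(3) by (simp add: u v ceq_Cons_cancel)
      then have "beq u' v'" using less.hyps[of u' v'] red' by (simp add: u)
      then show ?thesis using True by (simp add: u v beq_Cons)
    next
      case False
      have lu: "len u = length u" using less.prems(1) by (simp add: red_def)
      have "i # u \<approx> u'" using ceq_cancel2 by (simp add: u)
      then have di: "len (i # u) < len u" using len_le[of "i # u" u'] lu u by simp
      have "j # u \<approx> v'" using less.prems(3) by (simp add: v ceq_Cons_move)
      then have dj: "len (j # u) < len u" using len_le[of "j # u" v'] lu lenv' by simp
      have desc: "len (k # u) < len u" if "k \<in> {i, j}" for k using that di dj by auto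
      obtain n where n: "m i j = enat n"
      proof (cases "m i j")
        case infinity
        \<comment> \<open>For infinite \<open>m i j\<close> the element would begin with an
          alternating word longer than itself.\<close>
        then have "red_in {i, j} (alt_word (Suc (len u)) i j)"
          using False by (intro red_in_alt_word) auto
        with desc obtain t where "alt_word (Suc (len u)) i j @ t \<approx> u"
          "length (alt_word (Suc (len u)) i j) + length t = len u"
          by (rule descents_prefix)
        then show ?thesis by simp
      qed
      have "red_in {i, j} (alt_word n i j)" using False n by (intro red_in_alt_word) auto
      with desc obtain t where t: "alt_word n i j @ t \<approx> u" "length (alt_word n i j) + length t = len u"
        by (rule descents_prefix)
      have "n \<noteq> 0" using m_ge[OF False] n by (auto simp: numeral_eq_enat)
      then obtain p where p: "n = Suc p" by (cases n) auto
      define x y where "x = alt_word p j i @ t" and "y = alt_word p i j @ t"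
      have ix: "alt_word n i j @ t = i # x" and jy: "alt_word n j i @ t = j # y"
        by (auto simp: p x_def y_def)
      have lx: "length x = length u'" "length y = length v'"
        using t(2) lu lenv by (auto simp: p x_def y_def u v)
      have ux: "u' \<approx> x" using t(1) unfolding ix by (auto simp: u ceq_Cons_cancel intro: ceq_sym)
      have "red x" using ux lx red' by (simp add: red_def len_cong)
      then have "beq u' x" using ux less.hyps[of u' x] red' by (simp add: u)
      then have 1: "beq u (i # x)" by (simp add: u beq_Cons)
      have "j # y \<approx> i # x"
        using ceq_right[OF ceq_braid[OF n], of t] unfolding ix jy by (rule ceq_sym)
      also have "i # x \<approx> u" using t(1) unfolding ix .
      also have "u \<approx> j # v'" using less.prems(3) by (simp add: v)
      finally have vy: "v' \<approx> y" unfolding ceq_Cons_cancel by (rule ceq_sym)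
      have "red y" using vy lx red' by (simp add: red_def len_cong)
      then have "beq v' y" using vy less.hyps[of v' y] red' lenv' by simp
      then have 2: "beq v (j # y)" by (simp add: v beq_Cons)
      have "beq (i # x) (j # y)" using beq_alt_word[OF False n, of t] unfolding ix jy .
      then show ?thesis using 1 2 by (blast intro: word_cong.sym word_cong.trans)
    qed
  qed
qed

subsection \<open>The Hecke monoid acts on the Coxeter group\<close>

abbreviation heq :: "'i list \<Rightarrow> 'i list \<Rightarrow> bool" where
  "heq \<equiv> word_cong UNIV (hecke_rels UNIV m)"

lemma beq_imp_heq: "beq u v \<Longrightarrow> heq u v"
  by (induction rule: word_cong.induct)
    (auto simp: hecke_rels_def intro: word_cong.intros)

lemma heq_append: "heq u u' \<Longrightarrow> heq v v' \<Longrightarrow> heq (u @ v) (u' @ v')"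
  by (rule word_cong_append)

lemma heq_refl [simp]: "heq u u"
  by (simp add: word_cong.refl)

lemma heq_Cons: "heq u v \<Longrightarrow> heq (i # u) (i # v)"
  using heq_append[of "[i]" "[i]" u v] by simp

lemma heq_idem: "heq (i # i # u) (i # u)"
  using word_cong.rel[of "[i, i]" "[i]" "hecke_rels UNIV m" UNIV "[]" u] by (auto simp: hecke_rels_def)

text \<open>The Demazure operator, taken on words rather than classes: its value is literally
  \<open>x\<close> or \<open>i # x\<close>, which makes cosets and reducedness easy to
  follow.\<close>

definition dem_step :: "'i \<Rightarrow> 'i list \<Rightarrow> 'i list" where
  "dem_step i x = (if len x < len (i # x) then i # x else x)"

primrec dem :: "'i list \<Rightarrow> 'i list \<Rightarrow> 'i list" where
  "dem [] x = x"
| "dem (i # u) x = dem_step i (dem u x)"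

lemma dem_append [simp]: "dem (u @ v) x = dem u (dem v x)"
  by (induction u) auto

lemma dem_step_cong: "x \<approx> y \<Longrightarrow> dem_step i x \<approx> dem_step i y"
  using len_cong[of x y] len_cong[OF ceq_Cons, of x y i] by (simp add: dem_step_def ceq_Cons)

lemma dem_cong: "x \<approx> y \<Longrightarrow> dem u x \<approx> dem u y"
  by (induction u) (auto simp: dem_step_cong)

lemma dem_step_idem: "dem_step i (dem_step i x) = dem_step i x"
  using len_cong[OF ceq_cancel2, of i x] by (simp add: dem_step_def)

lemma dem_coset:
  assumes "u \<in> lists J" obtains v where "v \<in> lists J" "dem u x = v @ x"
proof -
  have "\<exists>v\<in>lists J. dem u x = v @ x"
    using assms
  proof (induction u)
    case (Cons i u)
    then obtain v where "v \<in> lists J" "dem u x = v @ x" by auto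
    then show ?case using Cons.hyps(1)
      by (auto simp: dem_step_def intro: bexI[of _ v] bexI[of _ "i # v"])
  qed (auto intro: bexI[of _ "[]"])
  then show ?thesis using that by blast
qed

text \<open>Invariant of the climb: either every step so far raised the length, or both letters are
  descents and all further steps are idle. The reversal makes \<open>a\<close> act first, whatever
  the parity of \<open>k\<close>.\<close>

lemma dem_alt_word_ascent:
  fixes a b :: 'i
  assumes "len x < len (a # x)"
  defines "z \<equiv> \<lambda>k. dem (rev (alt_word k a b)) x"
  shows "(len (a # z k) < len (z k) \<and> len (b # z k) < len (z k)) \<or>
    (z k = rev (alt_word k a b) @ x \<and> len (z k) = len x + k)"
proof (induction k)
  case 0
  show ?case by (simp add: z_def)
next
  case (Suc k)
  define c where "c = (if even k then a else b)"
  have rev_Suc: "rev (alt_word (Suc l) a b) = (if even l then a else b) # rev (alt_word l a b)" for l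
    unfolding alt_word_snoc by simp
  have z_Suc: "z (Suc k) = dem_step c (z k)"
    unfolding z_def rev_Suc by (simp add: c_def)
  show ?case
  proof (cases "len (a # z k) < len (z k) \<and> len (b # z k) < len (z k)")
    case True
    then have "z (Suc k) = z k" unfolding z_Suc by (auto simp: dem_step_def c_def)
    then show ?thesis using True by simp
  next
    case False
    then have zk: "z k = rev (alt_word k a b) @ x" "len (z k) = len x + k" using Suc.IH by auto
    show ?thesis
    proof (cases "len (z k) < len (c # z k)")
      case True
      then have "z (Suc k) = c # z k" unfolding z_Suc by (simp add: dem_step_def)
      moreover have "len (c # z k) = Suc (len (z k))" using True not_descent[of c "z k"] by simp
      ultimately show ?thesis using zk unfolding rev_Suc by (simp add: c_def)
    next
      case desc: False
      then have dc: "len (c # z k) < len (z k)" using len_Cons_neq[of c "z k"] by simp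
      \<comment> \<open>The first step cannot be refused, because \<open>a\<close> lengthens
        \<open>x\<close>. So there is a previous letter \<open>d\<close>, a descent since it was
        just put in front; \<open>c\<close> and \<open>d\<close> are \<open>a\<close> and
        \<open>b\<close> in some order.\<close>
      have "k \<noteq> 0"
      proof
        assume "k = 0"
        then show False using assms(1) desc zk by (simp add: c_def)
      qed
      then obtain l where l: "k = Suc l" by (cases k) auto
      define d where "d = (if even l then a else b)"
      have "d # z k \<approx> rev (alt_word l a b) @ x"
        using ceq_cancel2 zk(1) unfolding l rev_Suc by (simp add: d_def)
      then have "len (d # z k) \<le> l + len x"
        using len_append_le[of "rev (alt_word l a b)" x] len_cong by fastforce
      then have dd: "len (d # z k) < len (z k)" using zk(2) l by simp
      have False using dc dd False unfolding c_def d_def l by (auto split: if_splits)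
      then show ?thesis ..
    qed
  qed
qed

text \<open>A climb through all \<open>n\<close> steps ends in an alternating word of length
  \<open>n\<close> before the start, with lengths adding up. The braid relation lets that word begin
  with either letter, so both are descents after all.\<close>

lemma dem_alt_word_descents:
  fixes x :: "'i list"
  assumes "a \<noteq> b" "m a b = enat n"
  defines "z \<equiv> dem (rev (alt_word n a b)) x"
  shows "len (a # z) < len z \<and> len (b # z) < len z"
proof -
  have "n \<noteq> 0" using m_ge[OF assms(1)] assms(2) by (auto simp: numeral_eq_enat)
  then obtain p where p: "n = Suc p" by (cases n) auto
  have main: "len (a # z) < len z \<and> len (b # z) < len z"
    if asc: "len y < len (a # y)" and z: "z = dem (rev (alt_word n a b)) y" for z y
  proof (rule ccontr)
    assume none: "\<not> ?thesis"
    then have zy: "z = rev (alt_word n a b) @ y" "len z = len y + n"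
      using dem_alt_word_ascent[OF asc, where b = b and k = n] z by auto
    have less: "len (e # z) < len z" if "z \<approx> e # w @ y" "length w = p" for e w
    proof -
      have "e # z \<approx> w @ y" using that(1) by (simp add: ceq_Cons_move)
      then have "len (e # z) \<le> p + len y"
        using len_append_le[of w y] len_cong that(2) by metis
      then show ?thesis using zy p by simp
    qed
    have rev_n: "rev (alt_word n c d) = (if even p then c else d) # rev (alt_word p c d)" for c d
      unfolding p alt_word_snoc by simp
    have "z \<approx> (if even p then a else b) # rev (alt_word p a b) @ y"
      unfolding zy rev_n by simp
    moreover have "z \<approx> (if even p then b else a) # rev (alt_word p b a) @ y"
      using ceq_right[OF ceq_rev[OF ceq_braid[OF assms(2)]], of y]
      unfolding zy(1) rev_n by simp
    ultimately show False using none
        less[of a "rev (alt_word p a b)"] less[of b "rev (alt_word p b a)"]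
        less[of b "rev (alt_word p a b)"] less[of a "rev (alt_word p b a)"]
      by (cases "even p") simp_all
  qed
  show ?thesis
  proof (cases "len x < len (a # x)")
    case True
    then show ?thesis using main z_def by blast
  next
    case False
    then have "len (a # x) < len x" using len_Cons_neq[of a x] by simp
    \<comment> \<open>When \<open>a\<close> is already a descent it fixes \<open>x\<close>, while it
      takes the shorter \<open>v\<close> to \<open>a # v\<close>, which represents \<open>x\<close>.
      Starting from \<open>v\<close> thus gives the same element by a climb.\<close>
    then obtain v where v: "a # v \<approx> x" "red (a # v)" "red v" "len v < len (a # v)"
      by (rule descent_word)
    define z' where "z' = dem (rev (alt_word n a b)) v"
    have "z = dem (rev (alt_word p b a)) x" "z' = dem (rev (alt_word p b a)) (a # v)"
      unfolding z_def z'_def p using False v(4) by (simp_all add: dem_step_def)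
    then have zz: "z' \<approx> z" using dem_cong[OF v(1)] by simp
    have "len (a # z') < len z' \<and> len (b # z') < len z'" using main[OF v(4)] z'_def by blast
    then show ?thesis using len_cong[OF zz] len_cong[OF ceq_Cons[OF zz]] by simp
  qed
qed

text \<open>Both results lie in the same coset of the dihedral subgroup and have both letters as
  descents, which determines the element.\<close>

lemma dem_braid:
  assumes "i \<noteq> j" "m i j = enat n"
  shows "dem (alt_word n i j) x \<approx> dem (alt_word n j i) x"
proof -
  have desc: "len (k # dem (alt_word n c d) x) < len (dem (alt_word n c d) x)"
    if "{c, d} = {i, j}" "k \<in> {i, j}" for c d k
  proof -
    have "c \<noteq> d" "m c d = enat n" "m d c = enat n"
      using that(1) assms m_sym by (auto simp: doubleton_eq_iff)
    then show ?thesis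
      using dem_alt_word_descents[of c d n x] dem_alt_word_descents[of d c n x] that
        rev_alt_word[of n c d] rev_alt_word[of n d c]
      by (cases "even n") auto
  qed
  have "alt_word n i j \<in> lists {i, j}" using set_alt_word[of n i j] by (auto simp: lists_eq_set)
  then obtain v where v: "v \<in> lists {i, j}" "dem (alt_word n i j) x = v @ x" by (rule dem_coset)
  have "alt_word n j i \<in> lists {i, j}" using set_alt_word[of n j i] by (auto simp: lists_eq_set)
  then obtain w where w: "w \<in> lists {i, j}" "dem (alt_word n j i) x = w @ x" by (rule dem_coset)
  have "x \<approx> rev w @ dem (alt_word n j i) x"
    unfolding w(2) using ceq_sym[OF ceq_right[OF ceq_rev_left, of w x]] by simp
  from ceq_left[OF this, of v]
  have "dem (alt_word n i j) x \<approx> (v @ rev w) @ dem (alt_word n j i) x" by (simp add: v(2))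
  moreover have "v @ rev w \<in> lists {i, j}" using v(1) w(1) lists_rev by simp
  moreover have "{j, i} = {i, j}" by (rule insert_commute)
  ultimately show ?thesis
    using descents_unique[OF desc[of j i] desc[of i j]] by blast
qed

lemma dem_heq: "heq u v \<Longrightarrow> dem u x \<approx> dem v x"
proof (induction arbitrary: x rule: word_cong.induct)
  case (rel u v a b)
  have "dem u y \<approx> dem v y" for y
    using rel(1) dem_step_idem dem_braid by (auto simp: hecke_rels_def braid_rels_def)
  then show ?case by (simp add: dem_cong)
qed (auto intro: ceq_sym ceq_trans)

lemma red_dem: "red x \<Longrightarrow> red (dem u x)"
proof (induction u)
  case (Cons i u)
  then show ?case using not_descent[of i "dem u x"] by (auto simp: dem_step_def red_def)
qed simp

lemma dem_red: "red u \<Longrightarrow> dem u [] = u"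
proof (induction u)
  case (Cons i u)
  then have "red u" by (blast intro: red_tail)
  then show ?case using Cons by (simp add: dem_step_def red_def)
qed simp

lemma red_Nil [simp]: "red []"
  by (simp add: red_def)

text \<open>If \<open>i\<close> is a descent, Matsumoto's theorem moves \<open>x\<close> by braid
  relations to a word beginning with \<open>i\<close>, where idempotence absorbs the new
  letter.\<close>

lemma heq_dem_step:
  assumes "red x" shows "heq (i # x) (dem_step i x)"
proof (cases "len x < len (i # x)")
  case False
  then have "len (i # x) < len x" using len_Cons_neq[of i x] by simp
  then obtain v where v: "i # v \<approx> x" "red (i # v)" "red v" "len v < len (i # v)"
    by (rule descent_word)
  have xv: "heq x (i # v)" using v assms by (intro beq_imp_heq matsumoto) (auto intro: ceq_sym)
  have "heq (i # x) (i # v)" using heq_Cons[OF xv] heq_idem by (rule word_cong.trans)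
  then have "heq (i # x) x" using word_cong.sym[OF xv] by (rule word_cong.trans)
  then show ?thesis using False by (simp add: dem_step_def)
qed (simp add: dem_step_def)

lemma heq_dem: "red x \<Longrightarrow> heq (u @ x) (dem u x)"
proof (induction u)
  case (Cons i u)
  then have "heq ((i # u) @ x) (i # dem u x)" by (simp add: heq_Cons)
  then show ?case using heq_dem_step[OF red_dem[OF Cons.prems], of i u] word_cong.trans by fastforce
qed simp

text \<open>Hecke congruent words act alike on the identity, and a reduced word sends the identity
  to itself.\<close>

lemma heq_red_iff:
  assumes "red u" "red v" shows "heq u v \<longleftrightarrow> u \<approx> v"
proof
  assume "heq u v"
  then show "u \<approx> v" using dem_heq[of u v "[]"] assms by (simp add: dem_red)
next
  assume "u \<approx> v"
  then show "heq u v" using assms by (intro beq_imp_heq matsumoto)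
qed

subsection \<open>Longest elements\<close>

definition longest :: "'i set \<Rightarrow> 'i list \<Rightarrow> bool" where
  "longest J z \<longleftrightarrow> z \<in> lists J \<and> (\<forall>v\<in>lists J. len v \<le> len z)"

lemma longest_descent:
  assumes "longest J z" "j \<in> J" shows "len (j # z) < len z"
proof -
  have "j # z \<in> lists J" using assms by (simp add: longest_def)
  then have "len (j # z) \<le> len z" using assms unfolding longest_def by blast
  then show ?thesis using len_Cons_neq[of j z] by simp
qed

lemma longest_unique:
  assumes "longest J z" "longest J z'" shows "z' \<approx> z"
proof (rule descents_unique[of J])
  show "z' @ rev z \<in> lists J" using assms by (simp add: longest_def lists_rev)
  show "z' \<approx> (z' @ rev z) @ z" using ceq_sym[OF ceq_left[OF ceq_rev_left, of z' z]] by simp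
qed (use assms longest_descent in auto)

text \<open>The inverse of a longest element has the same length, so uniqueness makes it an
  involution.\<close>

lemma longest_square:
  assumes "longest J z" shows "z @ z \<approx> []"
proof -
  have "longest J (rev z)" using assms by (simp add: longest_def lists_rev len_rev)
  then have "rev z \<approx> z" using assms longest_unique by blast
  from ceq_left[OF this, of z] show ?thesis using ceq_rev_right ceq_sym ceq_trans by blast
qed

lemma longest_absorbs:
  assumes "longest J z" "red r" "r \<approx> z" "u \<in> lists J" shows "heq (u @ r) r"
proof -
  have "dem u r = r"
    using assms(4)
  proof (induction u)
    case (Cons j u)
    then have "len (j # r) < len r"
      using longest_descent[OF assms(1), of j] len_cong[OF assms(3)] len_cong[OF ceq_Cons[OF assms(3)]]
      by simp
    then show ?case using Cons by (simp add: dem_step_def)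
  qed simp
  then show ?thesis using heq_dem[OF assms(2)] by metis
qed

text \<open>The letters of \<open>r\<close> are not known to lie in \<open>J\<close>, so absorption
  does not apply to \<open>r @ r\<close> directly. A word \<open>v\<close> for \<open>z\<close> that
  is reduced over \<open>J\<close> is a prefix of \<open>z\<close> by
  \<open>descents_prefix\<close>, hence reduced outright; it replaces the left factor and is
  absorbed by the right one.\<close>

lemma longest_idempotent:
  assumes z: "longest J z" and r: "red r" "r \<approx> z" shows "heq (r @ r) r"
proof -
  have "z \<in> lists J" using z by (simp add: longest_def)
  then obtain v where v: "red_in J v" "z \<approx> v" by (rule red_in_word)
  have "\<And>j. j \<in> J \<Longrightarrow> len (j # z) < len z" using z by (rule longest_descent)
  then obtain t where "v @ t \<approx> z" "length v + length t = len z" using v(1) by (rule descents_prefix)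
  then have "length v \<le> len v" using len_cong[OF v(2)] by simp
  then have "red v" using len_le[OF ceq_refl, of v] by (simp add: red_def)
  moreover have "r \<approx> v" using r(2) v(2) by (rule ceq_trans)
  ultimately have "heq r v" using r(1) heq_red_iff by blast
  then have "heq (r @ r) (v @ r)" by (intro heq_append) auto
  moreover have "heq (v @ r) r" using v(1) z r by (intro longest_absorbs) (auto simp: red_in_def)
  ultimately show ?thesis by (rule word_cong.trans)
qed

end


section \<open>Coxeter matrices over a subset of a type\<close>

text \<open>Putting \<open>\<infinity>\<close> outside of \<open>I\<close> makes every letter of the type a generator and removes all
  membership side conditions; deleting the letters outside of \<open>I\<close> is a retraction.\<close>

definition ext_matrix :: "'i set \<Rightarrow> ('i \<Rightarrow> 'i \<Rightarrow> enat) \<Rightarrow> 'i \<Rightarrow> 'i \<Rightarrow> enat" where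
  "ext_matrix I m i j = (if i = j then 1 else if i \<in> I \<and> j \<in> I then m i j else \<infinity>)"

locale coxeter_on =
  fixes I :: "'i set" and m :: "'i \<Rightarrow> 'i \<Rightarrow> enat"
  assumes coxeter_matrix: "coxeter_matrix I m"
begin

sublocale coxeter "ext_matrix I m"
  using coxeter_matrix by unfold_locales (auto simp: ext_matrix_def coxeter_matrix_def)

notation ceq (infix "\<approx>" 50)

lemma ext_matrix_in: "i \<in> I \<Longrightarrow> j \<in> I \<Longrightarrow> ext_matrix I m i j = m i j"
  using coxeter_matrix by (auto simp: ext_matrix_def coxeter_matrix_def)

lemma ext_matrix_finite: "ext_matrix I m i j = enat n \<Longrightarrow> i \<noteq> j \<Longrightarrow> i \<in> I \<and> j \<in> I"
  by (auto simp: ext_matrix_def split: if_splits)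

definition keep :: "'i \<Rightarrow> 'i list" where
  "keep i = (if i \<in> I then [i] else [])"

lemma keep_lists [simp]: "w \<in> lists I \<Longrightarrow> concat (map keep w) = w"
  by (induction w) (auto simp: keep_def)

lemma keep_in_lists: "concat (map keep w) \<in> lists I"
  by (rule concat_map_in_lists[where X = UNIV]) (auto simp: keep_def)

lemma length_keep: "length (concat (map keep w)) \<le> length w"
  by (induction w) (auto simp: keep_def)

lemma alt_word_in_lists: "i \<in> I \<Longrightarrow> j \<in> I \<Longrightarrow> alt_word n i j \<in> lists I"
  using set_alt_word[of n i j] by (auto simp: lists_eq_set)

lemma braid_rels_ext: "braid_rels UNIV (ext_matrix I m) = braid_rels I m"
proof -
  have "i \<noteq> j \<and> ext_matrix I m i j = enat n \<longleftrightarrow> i \<in> I \<and> j \<in> I \<and> i \<noteq> j \<and> m i j = enat n" for i j n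
    by (auto simp: ext_matrix_def)
  then show ?thesis by (simp add: braid_rels_def)
qed

text \<open>One direction is inclusion of letters; the other applies the retraction
  \<open>keep\<close>, which fixes words over \<open>I\<close>.\<close>

lemma word_cong_UNIV_iff:
  assumes "R \<subseteq> R'"
    and R': "\<And>u v. (u, v) \<in> R' \<Longrightarrow>
      word_cong I R (concat (map keep u)) (concat (map keep v))"
    and "u \<in> lists I" "v \<in> lists I"
  shows "word_cong I R u v \<longleftrightarrow> word_cong UNIV R' u v"
proof
  assume "word_cong I R u v"
  then have "word_cong UNIV R' (concat (map (\<lambda>x. [x]) u)) (concat (map (\<lambda>x. [x]) v))"
  proof (rule word_cong_concat_map)
    fix u v assume "(u, v) \<in> R"
    then show "word_cong UNIV R' (concat (map (\<lambda>x. [x]) u)) (concat (map (\<lambda>x. [x]) v))"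
      using assms(1) word_cong.rel[of u v R' UNIV "[]" "[]"] by (auto simp: concat_map_singleton)
  qed simp
  then show "word_cong UNIV R' u v" by (simp only: concat_map_singleton list.map_ident)
next
  assume "word_cong UNIV R' u v"
  then have "word_cong I R (concat (map keep u)) (concat (map keep v))"
    by (rule word_cong_concat_map) (auto simp: keep_def R')
  then show "word_cong I R u v" using assms(3,4) by simp
qed

lemma braid_rels_in_lists: "(u, v) \<in> braid_rels I m \<Longrightarrow> u \<in> lists I \<and> v \<in> lists I"
  using alt_word_in_lists by (auto simp: braid_rels_def)

lemma braid_iff:
  assumes "u \<in> lists I" "v \<in> lists I"
  shows "word_cong I (braid_rels I m) u v \<longleftrightarrow> beq u v"
  using braid_rels_in_lists assms
  by (intro word_cong_UNIV_iff) (auto simp: braid_rels_ext intro: word_cong_relI)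

lemma hecke_iff:
  assumes "u \<in> lists I" "v \<in> lists I"
  shows "word_cong I (hecke_rels I m) u v \<longleftrightarrow> heq u v"
proof (rule word_cong_UNIV_iff)
  fix u v assume uv: "(u, v) \<in> hecke_rels UNIV (ext_matrix I m)"
  show "word_cong I (hecke_rels I m) (concat (map keep u)) (concat (map keep v))"
  proof (cases "(u, v) \<in> braid_rels I m")
    case True
    then show ?thesis using braid_rels_in_lists[OF True]
      by (auto simp: hecke_rels_def intro: word_cong_relI)
  next
    case False
    then obtain i where "u = [i, i]" "v = [i]" using uv by (auto simp: hecke_rels_def braid_rels_ext)
    then show ?thesis
      by (auto simp: keep_def hecke_rels_def intro: word_cong_relI word_cong.refl)
  qed
qed (use assms in \<open>auto simp: hecke_rels_def braid_rels_ext\<close>)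

lemma beq_imp_ceq: "beq u v \<Longrightarrow> u \<approx> v"
proof (induction rule: word_cong.induct)
  case (rel u v a b)
  then show ?case using ceq_braid by (auto simp: braid_rels_def intro!: ceq_left ceq_right)
qed (auto intro: ceq_sym ceq_trans)

section \<open>Signed words of the group presentation against unsigned words\<close>

abbreviation signed_cong :: "('i \<times> bool) list \<Rightarrow> ('i \<times> bool) list \<Rightarrow> bool" where
  "signed_cong \<equiv> word_cong (I \<times> UNIV) (group_rels I (coxeter_rels I m))"

abbreviation pos :: "'i list \<Rightarrow> ('i \<times> bool) list" where
  "pos \<equiv> map (\<lambda>i. (i, True))"

lemma pos_in_lists: "w \<in> lists I \<Longrightarrow> pos w \<in> lists (I \<times> UNIV)"
  by (induction w) auto

lemma fst_in_lists: "w \<in> lists (I \<times> UNIV) \<Longrightarrow> map fst w \<in> lists I"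
  by (induction w) auto

lemma pos_alt_word: "pos (alt_word (2 * n) i j) = concat (replicate n [(i, True), (j, True)])"
  by (induction n) auto

lemma signed_cong_rel:
  assumes "i \<in> I" "j \<in> I" "m i j = enat n"
  shows "signed_cong (pos (alt_word (2 * n) i j)) []"
  using assms alt_word_in_lists[of i j "2 * n"]
  by (intro word_cong_relI pos_in_lists)
    (auto simp: group_rels_def coxeter_rels_def pos_alt_word)

lemma signed_cong_pos:
  assumes "u \<approx> v" "u \<in> lists I" "v \<in> lists I" shows "signed_cong (pos u) (pos v)"
proof -
  have "signed_cong (concat (map (pos \<circ> keep) u)) (concat (map (pos \<circ> keep) v))"
    using assms(1)
  proof (rule word_cong_concat_map)
    fix u v assume "(u, v) \<in> word_rels"
    then obtain n i j where uv: "u = alt_word (2 * n) i j" "v = []" and n: "ext_matrix I m i j = enat n"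
      by (auto simp: word_rels_def)
    show "signed_cong (concat (map (pos \<circ> keep) u)) (concat (map (pos \<circ> keep) v))"
    proof (cases "i \<in> I \<and> j \<in> I")
      case True
      have "concat (map (pos \<circ> keep) w) = pos (concat (map keep w))" for w
        by (simp add: map_concat)
      then show ?thesis
        using True n signed_cong_rel[of i j n] alt_word_in_lists[of i j "2 * n"]
        by (simp add: uv ext_matrix_in)
    next
      case False
      then have "i = j" "i \<notin> I" using ext_matrix_finite[OF n] by auto
      then have "concat (map (pos \<circ> keep) (alt_word k i j)) = []" for k
        by (induction k) (auto simp: keep_def)
      from this[of "2 * n"] show ?thesis unfolding uv by (simp only: list.map concat.simps word_cong.refl lists.Nil)
    qed
  qed (auto simp: keep_def)
  moreover have "concat (map (pos \<circ> keep) w) = pos w" if "w \<in> lists I" for w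
    using that by (induction w) (auto simp: keep_def)
  ultimately show ?thesis using assms by simp
qed

lemma ceq_fst: "signed_cong u v \<Longrightarrow> map fst u \<approx> map fst v"
proof -
  assume "signed_cong u v"
  then have "concat (map (\<lambda>x. [fst x]) u) \<approx> concat (map (\<lambda>x. [fst x]) v)"
  proof (rule word_cong_concat_map)
    fix u v assume "(u, v) \<in> group_rels I (coxeter_rels I m)"
    then consider n i j where "u = pos (alt_word (2 * n) i j)" "v = []" "i \<in> I" "j \<in> I" "m i j = enat n"
      | i b where "u = [(i, b), (i, \<not> b)]" "v = []"
      by (auto simp: group_rels_def coxeter_rels_def pos_alt_word)
    then show "concat (map (\<lambda>x. [fst x]) u) \<approx> concat (map (\<lambda>x. [fst x]) v)"
    proof cases
      case 1
      then show ?thesis using ceq_rel[of i j n] by (simp add: ext_matrix_in concat_map_singleton comp_def)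
    next
      case 2
      then show ?thesis using ceq_square by simp
    qed
  qed simp
  then show ?thesis by (simp only: concat_map_singleton)
qed

lemma coxeter_class_eq_iff:
  assumes "u \<in> lists I" "v \<in> lists I"
  shows "coxeter_class I m u = coxeter_class I m v \<longleftrightarrow> u \<approx> v"
  unfolding coxeter_class_def word_class_eq_iff[OF pos_in_lists[OF assms(1)]]
  using signed_cong_pos[of u v] ceq_fst[of "pos u" "pos v"] assms by (auto simp: comp_def)

text \<open>A negative letter equals the positive one: put the trivial square of the positive letter
  after it and cancel the formal inverse.\<close>

lemma signed_cong_pos_fst:
  assumes "w \<in> lists (I \<times> UNIV)" shows "signed_cong w (pos (map fst w))"
  using assms
proof (induction w)
  case (Cons x w)
  obtain i b where x: "x = (i, b)" by fastforce
  have i: "i \<in> I" using Cons.hyps(1) x by simp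
  have "signed_cong [(i, b)] [(i, True)]"
  proof (cases b)
    case True
    then show ?thesis using i by (simp add: word_cong.refl)
  next
    case False
    have "signed_cong ([(i, False), (i, True)] @ [(i, True)]) ([] @ [(i, True)])"
      using i by (intro word_cong_append word_cong_relI word_cong.refl) (auto simp: group_rels_def)
    moreover have "signed_cong [(i, True), (i, True)] []"
      using signed_cong_rel[OF i i, of 1] coxeter_matrix i
      by (simp add: coxeter_matrix_def one_enat_def numeral_2_eq_2)
    then have "signed_cong ([(i, False)] @ [(i, True), (i, True)]) ([(i, False)] @ [])"
      using i by (intro word_cong_append word_cong.refl) auto
    ultimately show ?thesis using False by (auto intro: word_cong.sym word_cong.trans)
  qed
  from word_cong_append[OF this Cons.IH] show ?case by (simp add: x)
qed (simp add: word_cong.refl)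

subsection \<open>The Coxeter group\<close>

lemma coxeter_group_eq:
  "coxeter_group I m = presented_monoid (I \<times> UNIV) (group_rels I (coxeter_rels I m))"
  by (simp add: coxeter_group_def presented_group_def)

lemma carrier_coxeter_group: "carrier (coxeter_group I m) = coxeter_class I m ` lists I"
proof -
  have "word_class (I \<times> UNIV) (group_rels I (coxeter_rels I m)) w = coxeter_class I m (map fst w)"
    if "w \<in> lists (I \<times> UNIV)" for w
    unfolding coxeter_class_def word_class_eq_iff[OF that] using that by (rule signed_cong_pos_fst)
  then have "carrier (coxeter_group I m) = coxeter_class I m ` map fst ` lists (I \<times> (UNIV :: bool set))"
    by (simp add: coxeter_group_eq presented_monoid_carrier image_image cong: image_cong_simp)
  also have "map fst ` lists (I \<times> (UNIV :: bool set)) = lists I"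
    by (simp flip: lists_image)
  finally show ?thesis .
qed

lemma coxeter_class_mult:
  assumes "u \<in> lists I" "v \<in> lists I"
  shows "coxeter_class I m u \<otimes>\<^bsub>coxeter_group I m\<^esub> coxeter_class I m v = coxeter_class I m (u @ v)"
  using assms by (simp add: coxeter_group_eq coxeter_class_def presented_monoid_mult pos_in_lists)

lemma coxeter_one: "\<one>\<^bsub>coxeter_group I m\<^esub> = coxeter_class I m []"
  by (simp add: coxeter_group_eq coxeter_class_def presented_monoid_one)

text \<open>A shortest word might use letters outside \<open>I\<close>; \<open>keep\<close> removes
  them without lengthening it. Hence lengths over \<open>I\<close> and over the whole type
  agree.\<close>

lemma len_word_in:
  assumes "u \<in> lists I" obtains v where "v \<in> lists I" "u \<approx> v" "length v = len u" "red v"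
proof -
  obtain v where v: "u \<approx> v" "length v = len u" by (rule len_word)
  have "concat (map keep u) \<approx> concat (map keep v)"
    using v(1)
  proof (rule word_cong_concat_map)
    fix u v assume "(u, v) \<in> word_rels"
    then obtain n i j where uv: "u = alt_word (2 * n) i j" "v = []" and n: "ext_matrix I m i j = enat n"
      by (auto simp: word_rels_def)
    show "concat (map keep u) \<approx> concat (map keep v)"
    proof (cases "i \<in> I \<and> j \<in> I")
      case True
      then show ?thesis using ceq_rel[OF n] alt_word_in_lists by (simp add: uv)
    next
      case False
      then have "i = j" "i \<notin> I" using ext_matrix_finite[OF n] by auto
      then have "concat (map keep (alt_word k i j)) = []" for k
        by (induction k) (auto simp: keep_def)
      from this[of "2 * n"] show ?thesis unfolding uv by (simp only: list.map concat.simps ceq_refl)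
    qed
  qed simp
  then have *: "u \<approx> concat (map keep v)" using assms by simp
  moreover have len: "length (concat (map keep v)) = len u"
    using len_le[OF *] length_keep[of v] v(2) by simp
  moreover have "red (concat (map keep v))" using len len_cong[OF *] by (simp add: red_def)
  ultimately show ?thesis using that keep_in_lists by blast
qed

lemma coxeter_length_class:
  assumes "u \<in> lists I" shows "coxeter_length I m (coxeter_class I m u) = len u"
  unfolding coxeter_length_def
proof (rule Least_equality)
  obtain v where "v \<in> lists I" "u \<approx> v" "length v = len u" using assms by (rule len_word_in)
  then show "\<exists>is\<in>lists I. length is = len u \<and> coxeter_class I m is = coxeter_class I m u"
    using assms coxeter_class_eq_iff ceq_sym by blast
next
  fix n assume "\<exists>is\<in>lists I. length is = n \<and> coxeter_class I m is = coxeter_class I m u"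
  then obtain v where "v \<in> lists I" "length v = n" "v \<approx> u"
    using assms coxeter_class_eq_iff by blast
  then show "len u \<le> n" using len_le[OF ceq_sym, of v u] by simp
qed

text \<open>The very choice made in \<open>artin_lift\<close> and \<open>hecke_ident\<close>, so
  both unfold to classes of one and the same word.\<close>

definition rexp :: "('i \<times> bool) list set \<Rightarrow> 'i list" where
  "rexp w = (SOME is. reduced_expr I m w is)"

lemma rexp:
  assumes "w \<in> carrier (coxeter_group I m)"
  shows "rexp w \<in> lists I" "coxeter_class I m (rexp w) = w" "red (rexp w)"
proof -
  obtain u where u: "u \<in> lists I" "w = coxeter_class I m u"
    using assms unfolding carrier_coxeter_group by blast
  obtain v where v: "v \<in> lists I" "u \<approx> v" "length v = len u" using u(1) by (rule len_word_in)
  then have "reduced_expr I m w v"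
    using u coxeter_class_eq_iff[of v u] coxeter_length_class[of u]
    by (auto simp: reduced_expr_def intro: ceq_sym)
  then have "reduced_expr I m w (rexp w)" unfolding rexp_def by (rule someI)
  then show r: "rexp w \<in> lists I" "coxeter_class I m (rexp w) = w" and "red (rexp w)"
    using coxeter_length_class[of "rexp w"] by (auto simp: reduced_expr_def red_def)
qed

lemma rexp_coxeter_class: "u \<in> lists I \<Longrightarrow> rexp (coxeter_class I m u) \<approx> u"
  using rexp[of "coxeter_class I m u"] coxeter_class_eq_iff[of "rexp (coxeter_class I m u)" u]
  by (simp add: carrier_coxeter_group)

subsection \<open>The longest element of a finite parabolic subgroup\<close>

text \<open>\<open>generate\<close> also admits inverses, but the generators are involutions, so
  positive words reach everything.\<close>

lemma parabolic_eq:
  assumes "J \<subseteq> I" shows "parabolic I m J = coxeter_class I m ` lists J"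
proof -
  interpret W: monoid "coxeter_group I m"
    unfolding coxeter_group_eq by (rule monoid_presented_monoid)
  have JI: "u \<in> lists J \<Longrightarrow> u \<in> lists I" for u using assms lists_mono by blast
  have gen_inv: "inv\<^bsub>coxeter_group I m\<^esub> (coxeter_gen I m j) = coxeter_gen I m j" if "j \<in> J" for j
  proof (rule W.inv_unique'[symmetric])
    have "j \<in> I" using that assms by blast
    then show "coxeter_gen I m j \<otimes>\<^bsub>coxeter_group I m\<^esub> coxeter_gen I m j = \<one>\<^bsub>coxeter_group I m\<^esub>"
      using coxeter_class_eq_iff[of "[j, j]" "[]"] ceq_square
      by (simp add: coxeter_gen_def coxeter_class_mult coxeter_one)
    then show "coxeter_gen I m j \<otimes>\<^bsub>coxeter_group I m\<^esub> coxeter_gen I m j = \<one>\<^bsub>coxeter_group I m\<^esub>" .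
    show "coxeter_gen I m j \<in> carrier (coxeter_group I m)"
      using \<open>j \<in> I\<close> by (auto simp: coxeter_gen_def carrier_coxeter_group)
    then show "coxeter_gen I m j \<in> carrier (coxeter_group I m)" .
  qed
  have "w \<in> coxeter_class I m ` lists J" if "w \<in> parabolic I m J" for w
    using that unfolding parabolic_def
  proof (induction rule: generate.induct)
    case one
    then show ?case by (auto simp: coxeter_one)
  next
    case (incl h)
    then show ?case by (auto simp: coxeter_gen_def)
  next
    case (inv h)
    then obtain j where "j \<in> J" "h = coxeter_gen I m j" by blast
    then show ?case using gen_inv[of j] by (auto simp: coxeter_gen_def)
  next
    case (eng u v)
    then obtain a b where "a \<in> lists J" "b \<in> lists J" "u = coxeter_class I m a" "v = coxeter_class I m b"
      by blast
    then show ?case using JI coxeter_class_mult[of a b] by (auto intro!: imageI)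
  qed
  moreover have "coxeter_class I m u \<in> parabolic I m J" if "u \<in> lists J" for u
    using that
  proof (induction u)
    case Nil
    then show ?case by (simp add: parabolic_def generate.one flip: coxeter_one)
  next
    case (Cons j u)
    have "coxeter_gen I m j \<in> parabolic I m J"
      using Cons.hyps(1) unfolding parabolic_def by (intro generate.incl imageI)
    then have "coxeter_gen I m j \<otimes>\<^bsub>coxeter_group I m\<^esub> coxeter_class I m u \<in> parabolic I m J"
      using Cons.IH unfolding parabolic_def by (rule generate.eng)
    then show ?case
      using coxeter_class_mult[of "[j]" u] Cons.hyps JI assms by (auto simp: coxeter_gen_def)
  qed
  ultimately show ?thesis by blast
qed

text \<open>Finiteness of the subgroup supplies an element of maximal length, and
  \<open>longest_unique\<close> justifies the \<open>THE\<close>.\<close>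

lemma longest_elt:
  assumes "finite_type I m J"
  obtains z where "longest J z" "longest_elt I m J = coxeter_class I m z"
proof -
  have J: "J \<subseteq> I" and fin: "finite (parabolic I m J)" using assms by (auto simp: finite_type_def)
  have JI: "u \<in> lists J \<Longrightarrow> u \<in> lists I" for u using J lists_mono by blast
  have "finite (coxeter_length I m ` parabolic I m J)" using fin by simp
  also have "coxeter_length I m ` parabolic I m J = len ` lists J"
    unfolding parabolic_eq[OF J] image_image using coxeter_length_class JI by (intro image_cong) auto
  finally have fin: "finite (len ` lists J)" .
  have ne: "len ` lists J \<noteq> {}" by auto
  obtain z where max: "Max (len ` lists J) = len z" and z: "z \<in> lists J"
    using Max_in[OF fin ne] by (rule imageE)
  have lz: "longest J z" unfolding longest_def max[symmetric] using z Max_ge[OF fin] by blast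
  have long_iff: "(\<forall>v\<in>parabolic I m J. coxeter_length I m v \<le> coxeter_length I m (coxeter_class I m u))
      \<longleftrightarrow> longest J u" if "u \<in> lists J" for u
    using that JI coxeter_length_class by (auto simp: parabolic_eq[OF J] longest_def)
  have "longest_elt I m J = coxeter_class I m z"
    unfolding longest_elt_def
  proof (rule the_equality)
    show "coxeter_class I m z \<in> parabolic I m J \<and>
      (\<forall>v\<in>parabolic I m J. coxeter_length I m v \<le> coxeter_length I m (coxeter_class I m z))"
      using long_iff z lz by (auto simp: parabolic_eq[OF J])
  next
    fix w assume w: "w \<in> parabolic I m J \<and>
      (\<forall>v\<in>parabolic I m J. coxeter_length I m v \<le> coxeter_length I m w)"
    then obtain u where u: "u \<in> lists J" "w = coxeter_class I m u" by (auto simp: parabolic_eq[OF J])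
    then have "longest J u" using w long_iff by blast
    then have "u \<approx> z" using lz longest_unique by blast
    then show "w = coxeter_class I m z" using u z JI coxeter_class_eq_iff by simp
  qed
  then show ?thesis using that lz by blast
qed

lemma rexp_longest_elt:
  assumes "finite_type I m J"
  defines "r \<equiv> rexp (longest_elt I m J)"
  shows "r \<in> lists I" "coxeter_class I m r = longest_elt I m J" "r @ r \<approx> []" "heq (r @ r) r"
proof -
  obtain z where z: "longest J z" "longest_elt I m J = coxeter_class I m z"
    using assms(1) by (rule longest_elt)
  have "J \<subseteq> I" using assms(1) by (simp add: finite_type_def)
  then have zI: "z \<in> lists I" using z(1) lists_mono by (auto simp: longest_def)
  then have c: "longest_elt I m J \<in> carrier (coxeter_group I m)"
    using z(2) by (simp add: carrier_coxeter_group)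
  show "r \<in> lists I" "coxeter_class I m r = longest_elt I m J"
    using rexp[OF c] by (auto simp: r_def)
  have rz: "r \<approx> z" unfolding r_def z(2) using zI by (rule rexp_coxeter_class)
  show "r @ r \<approx> []" using ceq_append[OF rz rz] longest_square[OF z(1)] by (rule ceq_trans)
  show "heq (r @ r) r" using z(1) rexp(3)[OF c] rz unfolding r_def by (rule longest_idempotent)
qed

subsection \<open>The Hecke monoid\<close>

lemma hecke_ident_eq: "hecke_ident I m w = word_class I (hecke_rels I m) (rexp w)"
  by (simp add: hecke_ident_def rexp_def)

lemma hecke_ident_class:
  assumes "u \<in> lists I" "red u"
  shows "hecke_ident I m (coxeter_class I m u) = word_class I (hecke_rels I m) u"
proof -
  have c: "coxeter_class I m u \<in> carrier (coxeter_group I m)"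
    using assms by (simp add: carrier_coxeter_group)
  have "heq (rexp (coxeter_class I m u)) u"
    using heq_red_iff rexp(3)[OF c] assms rexp_coxeter_class by blast
  then show ?thesis
    unfolding hecke_ident_eq word_class_eq_iff[OF rexp(1)[OF c]] hecke_iff[OF rexp(1)[OF c] assms(1)] .
qed

text \<open>Injectivity is \<open>heq_red_iff\<close>. For surjectivity, letting a word act on the
  identity yields a reduced word that is Hecke congruent to it.\<close>

lemma bij_hecke_ident:
  "bij_betw (hecke_ident I m) (carrier (coxeter_group I m)) (carrier (hecke_presented I m))"
  unfolding bij_betw_def
proof
  show "inj_on (hecke_ident I m) (carrier (coxeter_group I m))"
  proof (rule inj_onI)
    fix v w assume v: "v \<in> carrier (coxeter_group I m)" and w: "w \<in> carrier (coxeter_group I m)"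
      and "hecke_ident I m v = hecke_ident I m w"
    then have "heq (rexp v) (rexp w)"
      using rexp(1)[OF v] rexp(1)[OF w] hecke_iff by (simp add: hecke_ident_eq word_class_eq_iff)
    then have "rexp v \<approx> rexp w" using rexp(3)[OF v] rexp(3)[OF w] heq_red_iff by blast
    then show "v = w" using coxeter_class_eq_iff rexp[OF v] rexp[OF w] by metis
  qed
  show "hecke_ident I m ` carrier (coxeter_group I m) = carrier (hecke_presented I m)"
  proof
    show "hecke_ident I m ` carrier (coxeter_group I m) \<subseteq> carrier (hecke_presented I m)"
      using rexp(1) by (auto simp: hecke_ident_eq hecke_presented_def presented_monoid_carrier)
    show "carrier (hecke_presented I m) \<subseteq> hecke_ident I m ` carrier (coxeter_group I m)"
    proof
      fix c assume "c \<in> carrier (hecke_presented I m)"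
      then obtain u where u: "u \<in> lists I" "c = word_class I (hecke_rels I m) u"
        by (auto simp: hecke_presented_def presented_monoid_carrier)
      \<comment> \<open>\<open>dem_coset\<close> serves to keep the letters of the resulting word in
        \<open>I\<close>.\<close>
      obtain v where v: "v \<in> lists I" "dem u [] = v @ []" using u(1) by (rule dem_coset)
      then have "heq u v" "red v" using heq_dem[of "[]" u] red_dem[of "[]" u] by auto
      then have "c = hecke_ident I m (coxeter_class I m v)"
        using u v(1) hecke_iff[of u v] by (simp add: hecke_ident_class word_class_eq_iff)
      then show "c \<in> hecke_ident I m ` carrier (coxeter_group I m)"
        using v(1) by (auto simp: carrier_coxeter_group)
    qed
  qed
qed

lemma hecke_ident_one: "hecke_ident I m \<one>\<^bsub>coxeter_group I m\<^esub> = \<one>\<^bsub>hecke_presented I m\<^esub>"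
  using hecke_ident_class[of "[]"]
  by (simp add: coxeter_one hecke_presented_def presented_monoid_one)

end

text \<open>The records in the conclusion have the shape of \<open>hecke_monoid\<close>, so a
  homomorphism of the presented Hecke monoids carries over to the set of group elements.\<close>

lemma monoid_hom_transport:
  assumes b: "bij_betw b C (carrier P)" and b': "bij_betw b' C' (carrier P')"
    and P: "monoid P" and h: "h \<in> monoid_hom P P'"
    and e: "e \<in> C" "b e = \<one>\<^bsub>P\<^esub>" and e': "e' \<in> C'" "b' e' = \<one>\<^bsub>P'\<^esub>"
  shows "(\<lambda>x. inv_into C' b' (h (b x))) \<in>
    monoid_hom \<lparr>carrier = C, mult = (\<lambda>u v. inv_into C b (b u \<otimes>\<^bsub>P\<^esub> b v)), one = e\<rparr>
      \<lparr>carrier = C', mult = (\<lambda>u v. inv_into C' b' (b' u \<otimes>\<^bsub>P'\<^esub> b' v)), one = e'\<rparr>"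
proof -
  have bC: "b x \<in> carrier P" if "x \<in> C" for x using b that by (auto simp: bij_betw_def)
  have hP: "h p \<in> carrier P'" if "p \<in> carrier P" for p
    using h that by (auto simp: monoid_hom_def hom_def)
  have inv: "b (inv_into C b p) = p" if "p \<in> carrier P" for p
    using b that by (simp add: bij_betw_inv_into_right)
  have inv': "b' (inv_into C' b' p) = p" if "p \<in> carrier P'" for p
    using b' that by (simp add: bij_betw_inv_into_right)
  have "inv_into C' b' p \<in> C'" if "p \<in> carrier P'" for p
    using b' that by (metis bij_betw_imp_surj_on inv_into_into)
  moreover have "inv_into C' b' \<one>\<^bsub>P'\<^esub> = e'"
    using b' e' by (metis bij_betw_inv_into_left)
  moreover have "h (b u \<otimes>\<^bsub>P\<^esub> b v) = h (b u) \<otimes>\<^bsub>P'\<^esub> h (b v)" if "u \<in> C" "v \<in> C" for u v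
    using h bC that by (auto simp: monoid_hom_def hom_def)
  moreover have "h \<one>\<^bsub>P\<^esub> = \<one>\<^bsub>P'\<^esub>" using h by (simp add: monoid_hom_def)
  ultimately show ?thesis
    using bC hP inv inv' e monoid.m_closed[OF P] by (simp add: monoid_hom_def hom_def)
qed

section \<open>Standard homomorphisms\<close>

theorem corollary1p1:
  fixes I :: "'i set" and m :: "'i \<Rightarrow> 'i \<Rightarrow> enat"
    and I' :: "'j set" and m' :: "'j \<Rightarrow> 'j \<Rightarrow> enat"
    and \<Phi> :: "'i list set \<Rightarrow> 'j list set"
    and J :: "'i \<Rightarrow> 'j set"
  assumes "finite I" and "coxeter_matrix I m"
    and "finite I'" and "coxeter_matrix I' m'"
    and "\<Phi> \<in> monoid_hom (artin_monoid I m) (artin_monoid I' m')"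
    and "\<And>i. i \<in> I \<Longrightarrow> finite_type I' m' (J i)"
    and "\<And>i. i \<in> I \<Longrightarrow> \<Phi> (artin_gen I m i) = artin_lift I' m' (longest_elt I' m' (J i))"
  shows "(\<exists>\<phi> \<in> hom (coxeter_group I m) (coxeter_group I' m').
            \<forall>i\<in>I. \<phi> (coxeter_gen I m i) = longest_elt I' m' (J i)) \<and>
         (\<exists>\<psi> \<in> monoid_hom (hecke_monoid I m) (hecke_monoid I' m').
            \<forall>i\<in>I. \<psi> (coxeter_gen I m i) = longest_elt I' m' (J i))"
proof -
  interpret A: coxeter_on I m using assms(2) by unfold_locales
  interpret B: coxeter_on I' m' using assms(4) by unfold_locales
  define r where "r i = B.rexp (longest_elt I' m' (J i))" for i
  define R where "R w = concat (map r w)" for w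
  note r = B.rexp_longest_elt[OF assms(6), folded r_def]
  have R_simps [simp]: "R [] = []" "R (i # w) = r i @ R w" "R (u @ v) = R u @ R v" for i w u v
    by (auto simp: R_def)
  have R_lists: "R w \<in> lists I'" if "w \<in> lists I" for w
    unfolding R_def using r(1) that by (rule concat_map_in_lists)

  have Phi: "\<Phi> (artin_class I m w) = artin_class I' m' (R w)" if "w \<in> lists I" for w
    using that
  proof (induction w)
    case Nil
    show ?case using assms(5)
      by (simp add: monoid_hom_def artin_monoid_def artin_class_def presented_monoid_one)
  next
    case (Cons i w)
    have "artin_class I m (i # w) = artin_gen I m i \<otimes>\<^bsub>artin_monoid I m\<^esub> artin_class I m w"
      using Cons.hyps presented_monoid_mult[of "[i]" I w "braid_rels I m"]
      by (simp add: artin_gen_def artin_class_def artin_monoid_def)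
    also have "\<Phi> \<dots> = \<Phi> (artin_gen I m i) \<otimes>\<^bsub>artin_monoid I' m'\<^esub> \<Phi> (artin_class I m w)"
      using assms(5) Cons.hyps
      by (intro hom_mult[of _ "artin_monoid I m"])
        (auto simp: monoid_hom_def artin_monoid_def artin_gen_def artin_class_def presented_monoid_carrier)
    also have "\<Phi> (artin_gen I m i) = artin_class I' m' (r i)"
      using assms(7) Cons.hyps(1) by (simp add: artin_lift_def r_def B.rexp_def)
    also have "artin_class I' m' (r i) \<otimes>\<^bsub>artin_monoid I' m'\<^esub> \<Phi> (artin_class I m w) =
        artin_class I' m' (R (i # w))"
      using Cons r(1)[OF Cons.hyps(1)] R_lists
      by (simp add: artin_class_def artin_monoid_def presented_monoid_mult)
    finally show ?case .
  qed
  \<comment> \<open>The two sides of a braid relation are one element of the source, so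
    \<open>\<Phi>\<close> gives them one image; \<open>Phi\<close> reads this as a braid equivalence
    of the substituted words.\<close>
  have R_braid: "word_cong I' (braid_rels I' m') (R u) (R v)" if uv: "(u, v) \<in> braid_rels I m" for u v
  proof -
    have l: "u \<in> lists I" "v \<in> lists I" using A.braid_rels_in_lists[OF uv] by auto
    have "artin_class I m u = artin_class I m v"
      unfolding artin_class_def word_class_eq_iff[OF l(1)] using uv l by (rule word_cong_relI)
    then have "artin_class I' m' (R u) = artin_class I' m' (R v)" using Phi l by metis
    then show ?thesis unfolding artin_class_def word_class_eq_iff[OF R_lists[OF l(1)]] .
  qed
  \<comment> \<open>\<open>R (rev w)\<close> is in general a different word from
    \<open>rev (R w)\<close>, but it still represents the inverse because every \<open>r i\<close>
    is an involution.\<close>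
  have R_rev: "B.ceq (R w @ R (rev w)) []" if "w \<in> lists I" for w
    using that
  proof (induction w)
    case (Cons i w)
    have "B.ceq (r i @ (R w @ R (rev w)) @ r i) (r i @ r i)"
      using B.ceq_conj[OF Cons.IH, of "r i" "r i"] by simp
    then show ?case using B.ceq_trans r(3)[OF Cons.hyps(1)] by fastforce
  qed simp
  have R_rel: "B.ceq (R (alt_word (2 * n) i j)) []" if ij: "i \<in> I" "j \<in> I" "m i j = enat n" for i j n
  proof (cases "i = j")
    case True
    then have "n = 1" using ij assms(2) by (auto simp: coxeter_matrix_def one_enat_def)
    then show ?thesis using True r(3)[OF ij(1)] by (simp add: numeral_2_eq_2)
  next
    case False
    then have "(alt_word n i j, alt_word n j i) \<in> braid_rels I m"
      using ij by (auto simp: braid_rels_def)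
    then have "B.ceq (R (alt_word n i j)) (R (alt_word n j i))"
      using R_braid B.braid_iff R_lists A.alt_word_in_lists ij B.beq_imp_ceq by metis
    then have "B.ceq (R (alt_word (2 * n) i j)) (R (alt_word n j i) @ R (rev (alt_word n j i)))"
      by (simp add: alt_word_double B.ceq_right)
    then show ?thesis using R_rev[OF A.alt_word_in_lists[OF ij(2,1)]] by (rule B.ceq_trans)
  qed

  have "\<exists>\<phi> \<in> hom (coxeter_group I m) (coxeter_group I' m').
            \<forall>i\<in>I. \<phi> (coxeter_gen I m i) = longest_elt I' m' (J i)"
  proof -
    \<comment> \<open>Both signs of a letter go to the same word; the formal inverse relations then
      hold because \<open>r i\<close> is an involution.\<close>
    let ?f = "\<lambda>x. B.pos (r (fst x))"
    have f: "concat (map ?f w) = B.pos (R (map fst w))" for w :: "('i \<times> bool) list"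
      by (induction w) auto
    have lists: "?f x \<in> lists (I' \<times> UNIV)" if "x \<in> I \<times> UNIV" for x :: "'i \<times> bool"
      using r(1) that by (intro B.pos_in_lists) auto
    have rels: "B.signed_cong (concat (map ?f u)) (concat (map ?f v))"
      if uv: "(u, v) \<in> group_rels I (coxeter_rels I m)" "u \<in> lists (I \<times> UNIV)" "v \<in> lists (I \<times> UNIV)"
      for u v
    proof -
      consider n i j where "u = A.pos (alt_word (2 * n) i j)" "v = []" "i \<in> I" "j \<in> I" "m i j = enat n"
        | i b where "u = [(i, b), (i, \<not> b)]" "v = []" "i \<in> I"
        using uv(1) by (auto simp: group_rels_def coxeter_rels_def A.pos_alt_word)
      then have "B.ceq (R (map fst u)) (R (map fst v))"
        by cases (auto simp: R_rel r(3) comp_def)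
      then show ?thesis
        unfolding f using uv A.fst_in_lists R_lists by (intro B.signed_cong_pos) auto
    qed
    have "\<exists>\<phi> \<in> monoid_hom (coxeter_group I m) (coxeter_group I' m'). \<forall>w\<in>lists (I \<times> UNIV).
        \<phi> (word_class (I \<times> UNIV) (group_rels I (coxeter_rels I m)) w) =
        word_class (I' \<times> UNIV) (group_rels I' (coxeter_rels I' m')) (B.pos (R (map fst w)))"
      using presented_monoid_hom[OF lists rels]
      unfolding A.coxeter_group_eq B.coxeter_group_eq f .
    then obtain \<phi> where \<phi>: "\<phi> \<in> monoid_hom (coxeter_group I m) (coxeter_group I' m')"
      "\<forall>w\<in>lists (I \<times> UNIV). \<phi> (word_class (I \<times> UNIV) (group_rels I (coxeter_rels I m)) w) =
        word_class (I' \<times> UNIV) (group_rels I' (coxeter_rels I' m')) (B.pos (R (map fst w)))"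
      by (elim bexE)
    have "\<phi> (coxeter_gen I m i) = longest_elt I' m' (J i)" if "i \<in> I" for i
      using \<phi>(2)[rule_format, of "[(i, True)]"] r(2)[OF that] that by (simp add: coxeter_gen_def coxeter_class_def)
    moreover have "\<phi> \<in> hom (coxeter_group I m) (coxeter_group I' m')" using \<phi>(1) by (simp add: monoid_hom_def)
    ultimately show ?thesis by blast
  qed
  moreover have "\<exists>\<psi> \<in> monoid_hom (hecke_monoid I m) (hecke_monoid I' m').
            \<forall>i\<in>I. \<psi> (coxeter_gen I m i) = longest_elt I' m' (J i)"
  proof -
    have rels: "word_cong I' (hecke_rels I' m') (concat (map r u)) (concat (map r v))"
      if uv: "(u, v) \<in> hecke_rels I m" "u \<in> lists I" "v \<in> lists I" for u v
    proof -
      have "B.heq (R u) (R v)"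
      proof (cases "(u, v) \<in> braid_rels I m")
        case True
        then show ?thesis using R_braid B.braid_iff B.beq_imp_heq R_lists uv by blast
      next
        case False
        then show ?thesis using uv r(4) by (auto simp: hecke_rels_def)
      qed
      then show ?thesis using B.hecke_iff R_lists uv unfolding R_def by blast
    qed
    have "\<exists>h \<in> monoid_hom (hecke_presented I m) (hecke_presented I' m'). \<forall>w\<in>lists I.
        h (word_class I (hecke_rels I m) w) = word_class I' (hecke_rels I' m') (R w)"
      unfolding hecke_presented_def R_def by (rule presented_monoid_hom[OF r(1) rels])
    then obtain h where h: "h \<in> monoid_hom (hecke_presented I m) (hecke_presented I' m')"
      "\<forall>w\<in>lists I. h (word_class I (hecke_rels I m) w) = word_class I' (hecke_rels I' m') (R w)"
      by (elim bexE)
    define \<psi> where "\<psi> = (\<lambda>x. inv_into (carrier (coxeter_group I' m')) (hecke_ident I' m')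
      (h (hecke_ident I m x)))"
    have one: "coxeter_class I m [] \<in> carrier (coxeter_group I m)"
      "coxeter_class I' m' [] \<in> carrier (coxeter_group I' m')"
      by (auto simp: A.carrier_coxeter_group B.carrier_coxeter_group)
    have "monoid (hecke_presented I m)"
      unfolding hecke_presented_def by (rule monoid_presented_monoid)
    then have "\<psi> \<in> monoid_hom (hecke_monoid I m) (hecke_monoid I' m')"
      unfolding hecke_monoid_def \<psi>_def
      using A.bij_hecke_ident B.bij_hecke_ident h(1) one
      by (intro monoid_hom_transport)
        (auto simp: A.hecke_ident_one B.hecke_ident_one A.coxeter_one B.coxeter_one
          simp flip: A.coxeter_one B.coxeter_one)
    moreover have "\<psi> (coxeter_gen I m i) = longest_elt I' m' (J i)" if "i \<in> I" for i
    proof -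
      \<comment> \<open>Parity rules out length 0, so \<open>[i]\<close> is reduced and
        \<open>hecke_ident\<close> takes the group generator to the Hecke generator.\<close>
      have "A.len [i] = 1"
        using A.len_Cons_le[of i "[]"] A.len_Cons_neq[of i "[]"] by simp
      then have "hecke_ident I m (coxeter_gen I m i) = word_class I (hecke_rels I m) [i]"
        unfolding coxeter_gen_def using that by (intro A.hecke_ident_class) (auto simp: A.red_def)
      then have "h (hecke_ident I m (coxeter_gen I m i)) = hecke_ident I' m' (longest_elt I' m' (J i))"
        using h(2)[rule_format, of "[i]"] that by (simp add: B.hecke_ident_eq r_def)
      moreover have "longest_elt I' m' (J i) \<in> carrier (coxeter_group I' m')"
        using r(1,2)[OF that] unfolding B.carrier_coxeter_group by (metis imageI)
      ultimately show ?thesis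
        unfolding \<psi>_def using B.bij_hecke_ident by (simp add: bij_betw_inv_into_left)
    qed
    ultimately show ?thesis by blast
  qed
  ultimately show ?thesis ..
qed

end
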